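(* Let $(X_1,Y_1),\dots,(X_n,Y_n)$ be i.i.d. with distribution $F=P_{\theta_0}$ on $\mathcal{X}\times\mathcal{Y}\subset\mathbb{R}^p\times\mathbb{R}$, let $L:(\mathcal{X}\times\mathcal{Y})\times\Theta\to[0,\infty[$ be a loss function with $\varphi=\partial_\theta L$, and let $J_\lambda:\Theta\to[0,\infty[$ be a (possibly non-differentiable) penalty. Set $$\varphi^\lambda((x,y),\theta)=\varphi((x,y),\theta)+J_\lambda'(\theta),\qquad \eta^\lambda(\theta)=\int\varphi((x,y),\theta)\,dF(x,y)+J_\lambda'(\theta).$$ Assume that there exists a sequence $(J_\lambda^m)_m$ of regularization functions $J_\lambda^m\in\mathcal{C}^\infty(\Theta)$ converging to $J_\lambda$ in the Sobolev space $W^{2,2}(\Theta)$. Assume further: (i) the parametric model $\mathcal{P}=\{P_\theta \mid \theta\in\Theta\}$ is $L_2$-differentiable, and if $\psi_\theta$ is an influence curve, then it belongs to $\Psi_2(\theta)$; (ii) $\Theta\subset\mathbb{R}^p$ is nonempty, compact and equals the topological closure of its interior; (iii) $\varphi^\lambda(\cdot,\theta)\in L_2^p(F)$ for all $\theta\in\Theta$; (iv) there is $\theta_0\in\Theta^\circ$ with $\eta^\lambda(\theta_0)=0$, and $\eta^\lambda$ is locally homeomorphic at $\theta_0$ with bounded and invertible derivative $d\eta^\lambda(\theta_0)$; (v) $J_\lambda$ is non-negative and convex with $J_\lambda(0_p)=0$; (vi) the learning procedure is $\sqrt n$-consistent (for $\theta_0$); (vii) the loss function $L$ is convex and twice continuously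 differentiable with respect to $\theta$. Then the sequence $(S_n^\lambda)_n$ of regularized M-estimators is asymptotically linear.
   Context: $p$ is finite. The underlying model is linear regression: $Y=f_\theta(X)+\epsilon$ with $f_\theta(X)=X\theta$, where the errors are i.i.d. with mean $0$ and variance in $]0,\infty[$; $L((x,y),\theta)$ is short for $L((x,y),f_\theta)$, and integration and differentiation in $\theta$ are interchangeable. $L_2^p(F)$ is the space of $\mathbb{R}^p$-valued functions square-integrable with respect to $F$. Where $J_\lambda$ is not classically differentiable, $J_\lambda'$ is its weak derivative. Convergence in $W^{2,2}(\Theta)$: $\big(\sum_{|\alpha|\le2}\int_\Theta|\partial^\alpha(J_\lambda^m(\theta)-J_\lambda(\theta))|^2d\theta\big)^{1/2}\to0$ as $m\to\infty$. Regularized M-estimator: the regularized risk is $R(\theta)=\mathbb{E}_F[L((X,Y),\theta)]+J_\lambda(\theta)$. $T_m$ denotes the M-functional that finds the zero of the Z-equation $\int\varphi\,dF+(J_\lambda^m)'(\theta)=0$ corresponding to the risk $R_m$ in which $J_\lambda$ is replaced by $J_\lambda^m$, and $T=\lim_mT_m$ is the M-functional corresponding to $J_\lambda$ (it does not depend on the approximating sequence). $S_n^\lambda$ is the value of $T$ for the empirical problem, i.e. with $F$ replaced by the empirical distribution of $(X_1,Y_1),\dots,(X_n,Y_n)$: it minimizes $\frac1n\sum_{i=1}^nL((X_i,Y_i),\theta)+J_\lambda(\theta)$ over $\theta\in\Theta$. $L_2$-differentiability: $\mathcal{P}$ is $L_2$-differentiable at $\theta_0$ if there is $\Lambda_{\theta_0}\in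 L_2^p(P_{\theta_0})$ with $\|\sqrt{dP_{\theta_0+h}}-\sqrt{dP_{\theta_0}}(1+\tfrac12h^T\Lambda_{\theta_0})\|_{L_2}=o(\|h\|)$ as $h\to0$. $\Psi_2(\theta_0)$ is the set of maps $\psi$ with $\psi\in L_2^p(P_{\theta_0})$, $\mathbb{E}_{\theta_0}[\psi]=0$ and $\mathbb{E}_{\theta_0}[\psi\Lambda_{\theta_0}^T]=I_p$. The influence curve of a statistical functional $T$ at $x$ for $P$ is $\lim_{t\to0}\,(T((1-t)P+t\delta_x)-T(P))/t$. Asymptotic linearity of $(S_n)_n$ at $P_{\theta_0}$: there is an influence curve $\psi_{\theta_0}\in\Psi_2(\theta_0)$ with $S_n=\theta_0+\frac1n\sum_{i=1}^n\psi_{\theta_0}(X_i,Y_i)+o_{P_{\theta_0}^n}(n^{-1/2})$. *)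

theory Defs
  imports "HOL-Probability.Probability" "HOL-Library.Landau_Symbols" "HOL-Library.Multiset"
begin

section \<open>Derivatives on a compact parameter set\<close>

text \<open>
  Derivatives on \<^term>\<open>\<Theta>\<close> are taken within \<^term>\<open>\<Theta>\<close>, that is, one-sided at boundary points. They are
  unique when \<^term>\<open>\<Theta>\<close> is convex with nonempty interior.
\<close>

definition gradient_on ::
    "(real^'p::finite) set \<Rightarrow> (real^'p \<Rightarrow> real) \<Rightarrow> (real^'p \<Rightarrow> real^'p) \<Rightarrow> bool" where
  "gradient_on \<Theta> f g \<longleftrightarrow> (\<forall>\<theta>\<in>\<Theta>. (f has_derivative (\<lambda>h. g \<theta> \<bullet> h)) (at \<theta> within \<Theta>))"

primrec Ck_on :: "nat \<Rightarrow> (real^'p::finite) set \<Rightarrow> (real^'p \<Rightarrow> real) \<Rightarrow> bool" where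
  "Ck_on 0 \<Theta> f \<longleftrightarrow> continuous_on \<Theta> f"
| "Ck_on (Suc k) \<Theta> f \<longleftrightarrow> (\<exists>g. gradient_on \<Theta> f g \<and> (\<forall>i. Ck_on k \<Theta> (\<lambda>\<theta>. g \<theta> $ i)))"

definition smooth_on :: "(real^'p::finite) set \<Rightarrow> (real^'p \<Rightarrow> real) \<Rightarrow> bool" where
  "smooth_on \<Theta> f \<longleftrightarrow> (\<forall>k. Ck_on k \<Theta> f)"


section \<open>Weak derivatives and convergence in $W^{2,2}$\<close>

text \<open>
  A multi-index $\alpha$ is a multiset of coordinates, with $|\alpha|$ = \<^term>\<open>size \<alpha>\<close>. The partial
  derivatives are applied in some order; the order does not matter because \<open>multi_partial\<close> is only
  used for smooth test functions.
\<close>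

definition partial :: "'p::finite \<Rightarrow> (real^'p \<Rightarrow> real) \<Rightarrow> real^'p \<Rightarrow> real" where
  "partial i f x = frechet_derivative f (at x) (axis i 1)"

definition multi_partial :: "'p::finite multiset \<Rightarrow> (real^'p \<Rightarrow> real) \<Rightarrow> real^'p \<Rightarrow> real" where
  "multi_partial \<alpha> f = foldr partial (SOME is. mset is = \<alpha>) f"

definition test_function :: "(real^'p::finite) set \<Rightarrow> (real^'p \<Rightarrow> real) \<Rightarrow> bool" where
  "test_function U \<zeta> \<longleftrightarrow>
     smooth_on UNIV \<zeta> \<and> compact (closure {x. \<zeta> x \<noteq> 0}) \<and> closure {x. \<zeta> x \<noteq> 0} \<subseteq> U"

definition locally_integrable_on :: "(real^'p::finite \<Rightarrow> real) \<Rightarrow> (real^'p) set \<Rightarrow> bool" where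
  "locally_integrable_on u U \<longleftrightarrow> (\<forall>K\<subseteq>U. compact K \<longrightarrow> u absolutely_integrable_on K)"

definition weak_derivative ::
    "(real^'p::finite) set \<Rightarrow> 'p multiset \<Rightarrow> (real^'p \<Rightarrow> real) \<Rightarrow> (real^'p \<Rightarrow> real) \<Rightarrow> bool" where
  "weak_derivative U \<alpha> u v \<longleftrightarrow>
     locally_integrable_on u U \<and> locally_integrable_on v U \<and>
     (\<forall>\<zeta>. test_function U \<zeta> \<longrightarrow>
        (LINT x:U|lebesgue. u x * multi_partial \<alpha> \<zeta> x) =
        (-1) ^ size \<alpha> * (LINT x:U|lebesgue. v x * \<zeta> x))"

lemma finite_multi_indices: "finite {\<alpha> :: 'p::finite multiset. size \<alpha> \<le> k}"
proof (rule finite_subset)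
  show "{\<alpha> :: 'p multiset. size \<alpha> \<le> k} \<subseteq> mset ` {xs. set xs \<subseteq> UNIV \<and> length xs \<le> k}"
  proof
    fix \<alpha> :: "'p multiset" assume "\<alpha> \<in> {\<alpha>. size \<alpha> \<le> k}"
    moreover obtain xs where "mset xs = \<alpha>" using ex_mset by blast
    ultimately show "\<alpha> \<in> mset ` {xs. set xs \<subseteq> UNIV \<and> length xs \<le> k}" by auto
  qed
  show "finite (mset ` {xs :: 'p list. set xs \<subseteq> UNIV \<and> length xs \<le> k})"
    by (intro finite_imageI finite_lists_length_le) simp
qed

text \<open>
  Weak derivatives live on the interior of \<^term>\<open>\<Theta>\<close>. For convex \<^term>\<open>\<Theta>\<close> the boundary is a null set,
  so the values of \<open>D m \<alpha>\<close> there do not affect the integrals over \<^term>\<open>\<Theta>\<close>.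
\<close>

definition tendsto_W22 ::
    "(real^'p::finite) set \<Rightarrow> (nat \<Rightarrow> real^'p \<Rightarrow> real) \<Rightarrow> (real^'p \<Rightarrow> real) \<Rightarrow> bool" where
  "tendsto_W22 \<Theta> Js J \<longleftrightarrow>
     (\<exists>D :: nat \<Rightarrow> 'p multiset \<Rightarrow> real^'p \<Rightarrow> real.
        (\<forall>m \<alpha>. size \<alpha> \<le> 2 \<longrightarrow>
           weak_derivative (interior \<Theta>) \<alpha> (\<lambda>\<theta>. Js m \<theta> - J \<theta>) (D m \<alpha>) \<and>
           set_integrable lebesgue \<Theta> (\<lambda>\<theta>. (D m \<alpha> \<theta>)\<^sup>2)) \<and>
        (\<lambda>m. sqrt (\<Sum>\<alpha> | size \<alpha> \<le> 2. LINT \<theta>:\<Theta>|lebesgue. (D m \<alpha> \<theta>)\<^sup>2)) \<longlonglongrightarrow> 0)"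

text \<open>
  The derivative of the penalty is the classical gradient wherever this exists. Elsewhere it is
  an (arbitrary) representative of the weak gradient.
\<close>

definition penalty_gradient ::
    "(real^'p::finite) set \<Rightarrow> (real^'p \<Rightarrow> real) \<Rightarrow> (real^'p \<Rightarrow> real^'p) \<Rightarrow> bool" where
  "penalty_gradient \<Theta> J J' \<longleftrightarrow>
     (\<forall>\<theta>\<in>\<Theta>. \<forall>g. (J has_derivative (\<lambda>h. g \<bullet> h)) (at \<theta> within \<Theta>) \<longrightarrow> J' \<theta> = g) \<and>
     (\<forall>i. weak_derivative (interior \<Theta>) {#i#} J (\<lambda>\<theta>. J' \<theta> $ i))"

definition locally_homeomorphic_at ::
    "(real^'p::finite) set \<Rightarrow> (real^'p \<Rightarrow> real^'p) \<Rightarrow> real^'p \<Rightarrow> bool" where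
  "locally_homeomorphic_at \<Theta> f \<theta> \<longleftrightarrow>
     (\<exists>U V g. open U \<and> \<theta> \<in> U \<and> U \<subseteq> \<Theta> \<and> open V \<and> homeomorphism U V f g)"


section \<open>The statistical model\<close>

text \<open>A data point is a pair $(x, y)$ in \<^term>\<open>X \<times> Y\<close>; all laws live on the trace Borel algebra.\<close>

definition sample_space ::
    "(real^'p::finite) set \<Rightarrow> real set \<Rightarrow> ((real^'p) \<times> real) measure" where
  "sample_space X Y = restrict_space borel (X \<times> Y)"

text \<open>
  Linear model $Y = X\theta + \epsilon$: under \<^term>\<open>P \<theta>\<close> the error $\epsilon = y - x\theta$ has
  mean $0$ and variance in $]0,\infty[$. For i.i.d. pairs the errors are i.i.d.
\<close>

definition linear_regression_model ::
    "((real^'p::finite) \<times> real) measure \<Rightarrow> (real^'p) set \<Rightarrow>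
       (real^'p \<Rightarrow> ((real^'p) \<times> real) measure) \<Rightarrow> bool"
  where
  "linear_regression_model N \<Theta> P \<longleftrightarrow>
     (\<forall>\<theta>\<in>\<Theta>. prob_space (P \<theta>) \<and> sets (P \<theta>) = sets N \<and>
        integrable (P \<theta>) (\<lambda>(x, y). y - x \<bullet> \<theta>) \<and>
        (\<integral>(x, y). y - x \<bullet> \<theta> \<partial>P \<theta>) = 0 \<and>
        integrable (P \<theta>) (\<lambda>(x, y). (y - x \<bullet> \<theta>)\<^sup>2) \<and>
        0 < (\<integral>(x, y). (y - x \<bullet> \<theta>)\<^sup>2 \<partial>P \<theta>))"

definition mixture :: "real \<Rightarrow> 'a measure \<Rightarrow> 'a measure \<Rightarrow> 'a measure" where
  "mixture t P Q = measure_of (space P) (sets P)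
     (\<lambda>A. ennreal (1 - t) * emeasure P A + ennreal t * emeasure Q A)"

definition L2_fun :: "'a measure \<Rightarrow> ('a \<Rightarrow> real^'p::finite) \<Rightarrow> bool" where
  "L2_fun P f \<longleftrightarrow> f \<in> borel_measurable P \<and> integrable P (\<lambda>z. (norm (f z))\<^sup>2)"

text \<open>
  The norm of $\xi\sqrt{dQ} - \zeta\sqrt{dP}$ in the Hilbert space of root measures. It does not
  depend on the dominating measure; $(P+Q)/2$ is used here.
\<close>

definition root_measure_dist ::
    "('a \<Rightarrow> real) \<Rightarrow> 'a measure \<Rightarrow> ('a \<Rightarrow> real) \<Rightarrow> 'a measure \<Rightarrow> real" where
  "root_measure_dist \<xi> Q \<zeta> P =
     (let \<mu> = mixture (1/2) P Q in
      sqrt (\<integral>z. (\<xi> z * sqrt (enn2real (RN_deriv \<mu> Q z)) -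
                 \<zeta> z * sqrt (enn2real (RN_deriv \<mu> P z)))\<^sup>2 \<partial>\<mu>))"

definition L2_derivative ::
    "(real^'p::finite \<Rightarrow> 'a measure) \<Rightarrow> real^'p \<Rightarrow> ('a \<Rightarrow> real^'p) \<Rightarrow> bool" where
  "L2_derivative P \<theta> \<Lambda> \<longleftrightarrow>
     L2_fun (P \<theta>) \<Lambda> \<and>
     (\<lambda>h. root_measure_dist (\<lambda>z. 1) (P (\<theta> + h)) (\<lambda>z. 1 + 1/2 * (h \<bullet> \<Lambda> z)) (P \<theta>)) \<in> o[at 0](norm)"

definition Psi2 :: "'a measure \<Rightarrow> ('a \<Rightarrow> real^'p::finite) \<Rightarrow> ('a \<Rightarrow> real^'p) set" where
  "Psi2 P \<Lambda> = {\<psi>. L2_fun P \<psi> \<and> (\<integral>z. \<psi> z \<partial>P) = 0 \<and>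
                  (\<integral>z. (\<chi> i j. \<psi> z $ i * \<Lambda> z $ j) \<partial>P) = (mat 1 :: real^'p^'p)}"

text \<open>The contaminated law is a probability measure only for $0 \le t \le 1$, hence $t \downarrow 0$.\<close>

definition influence_curve ::
    "('a measure \<Rightarrow> real^'p::finite) \<Rightarrow> 'a measure \<Rightarrow> ('a \<Rightarrow> real^'p) \<Rightarrow> bool" where
  "influence_curve T P \<psi> \<longleftrightarrow>
     (\<forall>z\<in>space P. ((\<lambda>t. (T (mixture t P (return P z)) - T P) /\<^sub>R t) \<longlongrightarrow> \<psi> z) (at_right 0))"


section \<open>M-functionals and M-estimators\<close>

definition functional_domain ::
    "'a measure \<Rightarrow> (real^'p::finite) set \<Rightarrow> ('a \<Rightarrow> real^'p \<Rightarrow> real) \<Rightarrow> ('a \<Rightarrow> real^'p \<Rightarrow> real^'p) \<Rightarrow>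
       'a measure set" where
  "functional_domain N \<Theta> L \<phi> =
     {G. prob_space G \<and> sets G = sets N \<and>
         (\<forall>\<theta>\<in>\<Theta>. integrable G (\<lambda>z. L z \<theta>) \<and> integrable G (\<lambda>z. \<phi> z \<theta>))}"

text \<open>
  A functional picks some solution whenever there is one; its value is left open at
  laws for which the Z-equation (the minimization problem) has no solution in \<^term>\<open>\<Theta>\<close>.
\<close>

definition Z_functional ::
    "'a measure set \<Rightarrow> (real^'p::finite) set \<Rightarrow> ('a \<Rightarrow> real^'p \<Rightarrow> real^'p) \<Rightarrow> (real^'p \<Rightarrow> real^'p) \<Rightarrow>
       ('a measure \<Rightarrow> real^'p) \<Rightarrow> bool" where
  "Z_functional \<D> \<Theta> \<phi> J' T \<longleftrightarrow>
     (\<forall>G\<in>\<D>. (\<exists>\<theta>\<in>\<Theta>. (\<integral>z. \<phi> z \<theta> \<partial>G) + J' \<theta> = 0) \<longrightarrow>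
        T G \<in> \<Theta> \<and> (\<integral>z. \<phi> z (T G) \<partial>G) + J' (T G) = 0)"

definition regularized_risk ::
    "('a \<Rightarrow> real^'p::finite \<Rightarrow> real) \<Rightarrow> (real^'p \<Rightarrow> real) \<Rightarrow> 'a measure \<Rightarrow> real^'p \<Rightarrow> real" where
  "regularized_risk L J G \<theta> = (\<integral>z. L z \<theta> \<partial>G) + J \<theta>"

definition M_functional ::
    "'a measure set \<Rightarrow> (real^'p::finite) set \<Rightarrow> ('a \<Rightarrow> real^'p \<Rightarrow> real) \<Rightarrow> (real^'p \<Rightarrow> real) \<Rightarrow>
       ('a measure \<Rightarrow> real^'p) \<Rightarrow> bool" where
  "M_functional \<D> \<Theta> L J T \<longleftrightarrow>
     (\<forall>G\<in>\<D>. (\<exists>\<theta>. is_arg_min (regularized_risk L J G) (\<lambda>\<theta>. \<theta> \<in> \<Theta>) \<theta>) \<longrightarrow>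
        is_arg_min (regularized_risk L J G) (\<lambda>\<theta>. \<theta> \<in> \<Theta>) (T G))"

definition empirical_measure :: "'a measure \<Rightarrow> (nat \<Rightarrow> 'a) \<Rightarrow> nat \<Rightarrow> 'a measure" where
  "empirical_measure N z n = distr (uniform_count_measure {..<n}) N z"


section \<open>Asymptotics\<close>

definition root_n_consistent ::
    "'w measure \<Rightarrow> (nat \<Rightarrow> 'w \<Rightarrow> real^'p::finite) \<Rightarrow> real^'p \<Rightarrow> bool" where
  "root_n_consistent M S \<theta>\<^sub>0 \<longleftrightarrow>
     (\<forall>e>0. \<exists>C. \<forall>\<^sub>F n in sequentially.
        measure M {\<omega>\<in>space M. sqrt (real n) * norm (S n \<omega> - \<theta>\<^sub>0) > C} < e)"

definition small_o_prob ::
    "'w measure \<Rightarrow> (nat \<Rightarrow> real) \<Rightarrow> (nat \<Rightarrow> 'w \<Rightarrow> real^'p::finite) \<Rightarrow> bool" where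
  "small_o_prob M a R \<longleftrightarrow>
     (\<forall>e>0. (\<lambda>n. measure M {\<omega>\<in>space M. norm (R n \<omega>) > e * a n}) \<longlonglongrightarrow> 0)"

text \<open>
  \<^term>\<open>S\<close> is the estimator sequence induced by the functional \<^term>\<open>T\<close> on the sample \<^term>\<open>Z\<close>,
  \<^term>\<open>F\<close> the law of a data point and \<^term>\<open>\<Lambda>\<close> the \<open>L\<^sub>2\<close>-derivative of the model at \<open>\<theta>\<^sub>0\<close>.
\<close>

definition asymptotically_linear ::
    "('a measure \<Rightarrow> real^'p::finite) \<Rightarrow> 'a measure \<Rightarrow> ('a \<Rightarrow> real^'p) \<Rightarrow> real^'p \<Rightarrow>
       'w measure \<Rightarrow> (nat \<Rightarrow> 'w \<Rightarrow> 'a) \<Rightarrow> (nat \<Rightarrow> 'w \<Rightarrow> real^'p) \<Rightarrow> bool" where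
  "asymptotically_linear T F \<Lambda> \<theta>\<^sub>0 M Z S \<longleftrightarrow>
     (\<exists>\<psi>. influence_curve T F \<psi> \<and> \<psi> \<in> Psi2 F \<Lambda> \<and>
        small_o_prob M (\<lambda>n. 1 / sqrt (real n))
          (\<lambda>n \<omega>. S n \<omega> - (\<theta>\<^sub>0 + (\<Sum>i<n. \<psi> (Z i \<omega>)) /\<^sub>R real n)))"

end

theory Submission
  imports Defs
begin

text \<open>
  Convexity reduces the asymptotics of the minimizer to pointwise convergence of the objective.
  Let $\Phi(\theta) = E_F[L(Z,\theta)] + J(\theta)$ be the regularized risk. The Z-equation says that
  $\eta(\theta_0) = 0$, and $H = d\eta(\theta_0)$ will turn out to be the Hessian of $\Phi$ there.

  Even a non-differentiable penalty has no kinks near $\theta_0$. A convex function is differentiable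
  on a dense set, and there the gradient of $\Phi$ is $\eta$. Since $\eta$ is continuous near $\theta_0$, the
  subgradient inequality passes to the limit and $\Phi$ is continuously differentiable near
  $\theta_0$ with gradient $\eta$ (\<open>convex_gradient_extends\<close>). Hence $H$ is symmetric and
  $\Phi(\theta_0 + su) = \Phi(\theta_0) + s^2 (u \cdot Hu)/2 + o(s^2)$; it is positive semidefinite
  because $\theta_0$ minimizes $\Phi$, and definite because it is invertible.

  Now let $f$ be a perturbation of $\Phi$, either the risk under the contaminated law
  $(1-s)F + s\delta_z$ or the empirical risk of $n$ observations with $s = n^{-1/2}$. In the local
  parameter $u = (\theta - \theta_0)/s$ the convex function $(f(\theta_0 + su) - f(\theta_0))/s^2$ is
  close to the quadratic $-Hv \cdot u + (u \cdot Hu)/2$ at each $u$, whose minimizer is $v$. Here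
  $v = \psi(z)$ for the contaminated law, $v = n^{-1/2}\sum_i \psi(Z_i)$ for the sample, and
  $\psi(z) = -H^{-1}(\varphi(z,\theta_0) - E_F\,\varphi(\cdot,\theta_0))$, which equals
  $-H^{-1}\varphi^\lambda(z,\theta_0)$ by the Z-equation. Convex functions that are close to a
  continuous function on a finite set are uniformly close to it on a ball
  (\<open>convex_uniform_of_net\<close>), and a convex function that is larger on a sphere than at the centre
  has all of its minimizers inside the ball (\<open>convex_minimizers_in_ball\<close>). So finitely many
  pointwise estimates show that minimizers exist and that their local parameter is near $v$
  (\<open>perturbed_quadratic_minimizers\<close>).

  For the contaminated law the pointwise estimate follows from differentiability, and the conclusion is that
  $\psi$ is the influence curve (\<open>contaminated_minimizers\<close>); the assumption on influence curves
  then gives $\psi \in \Psi_2(\theta_0)$. For the sample the estimate holds in probability by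
  Chebyshev's inequality. The variance that appears there is at most the second moment of
  $(L(z,\theta_0+su) - L(z,\theta_0) - s\,\varphi(z,\theta_0) \cdot u)/s$, which by convexity decreases
  to $0$ as $s \downarrow 0$, so that dominated convergence applies. The conclusion is the expansion of
  the estimator (\<open>empirical_minimizers\<close>).
\<close>

section \<open>Convex functions and their minimizers\<close>

text \<open>
  If a point outside the ball were no higher than the centre, then by convexity neither would be the
  point where the segment to it crosses the sphere. Existence is included because the function
  need not be lower semicontinuous at the boundary of \<open>S\<close>, so compactness of \<open>S\<close> alone
  would not provide a minimizer.
\<close>

lemma convex_minimizers_in_ball:
  fixes f :: "'a::euclidean_space \<Rightarrow> real"
  assumes f: "convex_on S f" and r: "r > 0" and sub: "cball a r \<subseteq> S"
    and cont: "continuous_on (cball a r) f"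
    and sphere: "\<And>x. dist a x = r \<Longrightarrow> f a < f x"
  shows "\<exists>x. is_arg_min f (\<lambda>x. x \<in> S) x"
    and "is_arg_min f (\<lambda>x. x \<in> S) x \<Longrightarrow> x \<in> ball a r"
proof -
  have a: "a \<in> S" using sub r by auto
  have outside: "f a < f y" if y: "y \<in> S" "dist a y \<ge> r" for y
  proof -
    define s where "s = r / dist a y"
    have pos: "dist a y > 0" using y r by linarith
    have s: "0 < s" "s \<le> 1" using pos y r by (auto simp: s_def)
    have "dist a ((1 - s) *\<^sub>R a + s *\<^sub>R y) = norm (s *\<^sub>R (a - y))"
      unfolding dist_norm by (simp add: algebra_simps)
    also have "\<dots> = r" using pos r by (simp add: s_def dist_norm)
    finally have "f a < f ((1 - s) *\<^sub>R a + s *\<^sub>R y)" using sphere by blast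
    also have "\<dots> \<le> (1 - s) * f a + s * f y"
      using convex_onD[OF f, of s a y] s a y by simp
    finally have "s * f a < s * f y" by (simp add: algebra_simps)
    thus ?thesis using s by simp
  qed
  obtain x where x: "x \<in> cball a r" "\<And>y. y \<in> cball a r \<Longrightarrow> f x \<le> f y"
    using continuous_attains_inf[OF compact_cball _ cont] r by auto
  have "f x \<le> f y" if "y \<in> S" for y
    using x(2)[of y] x(2)[of a] outside[OF that] r by (cases "dist a y \<le> r") auto
  then show "\<exists>x. is_arg_min f (\<lambda>x. x \<in> S) x"
    using x(1) sub by (intro exI[of _ x]) (auto simp: is_arg_min_def not_less)
  show "x \<in> ball a r" if "is_arg_min f (\<lambda>x. x \<in> S) x" for x
    using that outside[of x] a by (force simp: is_arg_min_def)
qed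

text \<open>
  Prolong the segment from \<open>x\<close> to \<open>y\<close> by the length \<open>R\<close>; the slope of a convex function over
  the segment is at most the slope over the prolongation, where the function changes by at most
  \<open>2 * B\<close>.
\<close>

lemma convex_on_lipschitz_of_bounded:
  fixes g :: "'a::real_normed_vector \<Rightarrow> real"
  assumes g: "convex_on S g" and R: "R > 0" and sub: "cball 0 (2 * R) \<subseteq> S"
    and bd: "\<And>u. norm u \<le> 2 * R \<Longrightarrow> \<bar>g u\<bar> \<le> B"
    and xy: "norm x \<le> R" "norm y \<le> R"
  shows "g y - g x \<le> 2 * B / R * norm (y - x)"
proof (cases "y = x")
  case False
  define d where "d = norm (y - x)"
  have d: "d > 0" using False by (simp add: d_def)
  define z where "z = y + (R / d) *\<^sub>R (y - x)"
  have "norm z \<le> norm y + norm ((R / d) *\<^sub>R (y - x))" unfolding z_def by (rule norm_triangle_ineq)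
  also have "norm ((R / d) *\<^sub>R (y - x)) = R" using d R by (simp add: d_def)
  finally have z: "norm z \<le> 2 * R" using xy by simp
  define s where "s = d / (d + R)"
  have s: "0 < s" "s < 1" using d R by (auto simp: s_def)
  have sz: "s *\<^sub>R z = s *\<^sub>R y + (1 - s) *\<^sub>R (y - x)"
  proof -
    have "s * (R / d) = 1 - s" using d R by (simp add: s_def field_simps)
    thus ?thesis by (simp add: z_def scaleR_add_right)
  qed
  have y: "y = (1 - s) *\<^sub>R x + s *\<^sub>R z" unfolding sz by (simp add: algebra_simps)
  have "g y \<le> (1 - s) * g x + s * g z"
    unfolding y using convex_onD[OF g, of s x z] s z xy sub R by (auto simp: subset_iff)
  then have "g y - g x \<le> s * (g z - g x)" by (simp add: algebra_simps)
  also have "\<dots> \<le> s * (2 * B)"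
    using bd[of z] bd[of x] z xy R s by (intro mult_left_mono) auto
  also have "\<dots> \<le> (d / R) * (2 * B)"
  proof (rule mult_right_mono)
    show "s \<le> d / R" unfolding s_def using d R by (intro divide_left_mono) auto
    show "0 \<le> 2 * B" using bd[of 0] R by auto
  qed
  finally show ?thesis by (simp add: d_def mult.commute)
qed simp

lemma cball_subset_hull_finite:
  fixes R :: real
  assumes "R > 0"
  obtains K :: "'a::euclidean_space set" where "finite K" "cball 0 R \<subseteq> convex hull K"
proof -
  obtain K :: "'a set" where K: "finite K"
    "cbox (0 - (\<Sum>i\<in>Basis. R *\<^sub>R i)) (0 + (\<Sum>i\<in>Basis. R *\<^sub>R i)) = convex hull K"
    using cube_convex_hull[OF assms, of 0] by blast
  have "cball 0 R \<subseteq> convex hull K"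
  proof
    fix x :: 'a assume "x \<in> cball 0 R"
    then have "\<bar>x \<bullet> i\<bar> \<le> R" if "i \<in> Basis" for i
      using Basis_le_norm[OF that, of x] by simp
    then show "x \<in> convex hull K"
      unfolding K(2)[symmetric] by (auto simp: mem_box abs_le_iff minus_le_iff)
  qed
  with K(1) show thesis by (rule that)
qed

text \<open>
  The set \<open>K\<close> and the tolerance serve all convex functions at once. The vertices of a large cube in
  \<open>K\<close> bound \<open>g\<close> from above on the cube, and with the value at \<open>0\<close> reflection bounds it from
  below. Hence all these \<open>g\<close> share a Lipschitz constant on the ball, and a fine enough net of the
  ball transfers the closeness from \<open>K\<close> to every point.
\<close>

lemma convex_uniform_of_net:
  fixes q :: "'a::euclidean_space \<Rightarrow> real"
  assumes q: "continuous_on UNIV q" and R: "R > 0" and e: "e > 0"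
  obtains K \<delta> where "finite K" "\<delta> > 0"
    "\<And>S g u. convex_on S g \<Longrightarrow> K \<subseteq> S \<Longrightarrow> (\<And>k. k \<in> K \<Longrightarrow> \<bar>g k - q k\<bar> \<le> \<delta>) \<Longrightarrow> norm u \<le> R \<Longrightarrow>
        \<bar>g u - q u\<bar> \<le> e"
proof -
  obtain K1 :: "'a set" where K1: "finite K1" "cball 0 (2 * R) \<subseteq> convex hull K1"
    using cball_subset_hull_finite[of "2 * R"] R by auto
  define B where "B = Max ((\<lambda>u. \<bar>q u\<bar>) ` insert 0 K1) + 1"
  have B: "\<bar>q u\<bar> + 1 \<le> B" if "u \<in> insert 0 K1" for u
    unfolding B_def using K1(1) that by (intro add_right_mono Max_ge) auto
  define l where "l = 2 * (3 * B) / R"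
  have l: "l > 0" using B[of 0] R by (auto simp: l_def)
  have "uniformly_continuous_on (cball 0 R) q"
    by (intro compact_uniformly_continuous continuous_on_subset[OF q]) auto
  then obtain d where d: "d > 0"
    "\<And>x y. x \<in> cball 0 R \<Longrightarrow> y \<in> cball 0 R \<Longrightarrow> dist y x < d \<Longrightarrow> dist (q y) (q x) < e / 3"
    using e unfolding uniformly_continuous_on_def by (metis divide_pos_pos zero_less_numeral)
  define h where "h = min d (e / (3 * l))"
  have h: "h > 0" using d e l by (simp add: h_def)
  obtain K2 :: "'a set" where K2: "finite K2" "K2 \<subseteq> cball 0 R" "cball 0 R \<subseteq> (\<Union>x\<in>K2. ball x h)"
    by (rule compactE_image[OF compact_cball[of "0::'a" R], of "cball 0 R" "\<lambda>x. ball x h"])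
      (use h in force)+
  define K where "K = insert 0 (K1 \<union> K2)"
  show thesis
  proof (rule that)
    show "finite K" using K1 K2 by (simp add: K_def)
    show "min 1 (e / 3) > 0" using e by simp
    fix S g u
    assume g: "convex_on S g" and KS: "K \<subseteq> S" and cl: "\<And>k. k \<in> K \<Longrightarrow> \<bar>g k - q k\<bar> \<le> min 1 (e / 3)"
      and u: "norm (u::'a) \<le> R"
    have cl1: "\<bar>g k - q k\<bar> \<le> 1" if "k \<in> K" for k using cl[OF that] by simp
    have "convex S" using g by (rule convex_on_imp_convex)
    then have hull: "convex hull K1 \<subseteq> S" using KS by (intro hull_minimal) (auto simp: K_def)
    have "\<forall>x\<in>K1. g x \<le> B"
    proof
      fix x assume "x \<in> K1"
      then have "x \<in> K" "\<bar>q x\<bar> + 1 \<le> B" using B[of x] by (auto simp: K_def)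
      with cl1[of x] show "g x \<le> B" by linarith
    qed
    then have up: "g x \<le> B" if "norm x \<le> 2 * R" for x
      using convex_on_convex_hull_bound[of K1 g B] convex_on_subset[OF g hull] K1(2) that
      by (auto simp: subset_iff)
    \<comment> \<open>the lower bound comes from convexity between \<open>x\<close> and its reflection\<close>
    have bd: "\<bar>g x\<bar> \<le> 3 * B" if x: "norm x \<le> 2 * R" for x
    proof -
      have "g ((1 - 1/2) *\<^sub>R x + (1/2) *\<^sub>R (- x)) \<le> (1 - 1/2) * g x + (1/2) * g (- x)"
        using K1(2) hull x by (intro convex_onD[OF g]) (auto simp: subset_iff)
      then have "2 * g 0 \<le> g x + g (- x)" by simp
      moreover have "0 \<in> K" "\<bar>q 0\<bar> + 1 \<le> B" using B[of 0] by (auto simp: K_def)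
      with cl1[of 0] have "g 0 \<ge> - B" by linarith
      ultimately show ?thesis using up[OF x] up[of "- x"] x by simp
    qed
    have lip: "g y - g x \<le> l * norm (y - x)" if "norm x \<le> R" "norm y \<le> R" for x y
      unfolding l_def using hull K1(2) bd that
      by (intro convex_on_lipschitz_of_bounded[OF g R]) auto
    obtain k where k: "k \<in> K2" "dist k u < h" using K2(3) u by auto
    have kR: "norm k \<le> R" using k K2 by auto
    have "l * norm (u - k) \<le> l * (e / (3 * l))"
      using k l unfolding h_def by (intro mult_left_mono) (auto simp: dist_norm norm_minus_commute)
    then have "l * norm (u - k) \<le> e / 3" using l by simp
    then have "\<bar>g u - g k\<bar> \<le> e / 3"
      using lip[OF u kR] lip[OF kR u] unfolding norm_minus_commute[of k u] by linarith
    moreover have "\<bar>q k - q u\<bar> < e / 3"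
      using d(2)[of u k] u kR k by (simp add: dist_real_def h_def)
    moreover have "\<bar>g k - q k\<bar> \<le> e / 3" using cl[of k] k by (simp add: K_def)
    ultimately show "\<bar>g u - q u\<bar> \<le> e" by linarith
  qed
qed

text \<open>
  In the local parameter $u = (x - x_0)/s$ the increment of \<open>f\<close>, divided by \<open>s\<^sup>2\<close>, is compared with
  the quadratic $-Hv \cdot u + (u \cdot Hu)/2$. This has the minimum point \<open>v\<close> and exceeds its minimum by
  at least \<open>c * e\<^sup>2 / 2\<close> at distance \<open>e\<close>. The error \<open>c * e\<^sup>2 / 8\<close> used for the uniform
  closeness, incurred at both points, is too small to close this gap. The constants depend on \<open>v\<close>
  only through the bound \<open>R\<close>, which is needed because \<open>v\<close> is random in the application to samples.
\<close>

lemma perturbed_quadratic_minimizers: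
  fixes H :: "'a::euclidean_space \<Rightarrow> 'a"
  assumes lin: "linear H" and sym: "\<And>x y. H x \<bullet> y = x \<bullet> H y"
    and c: "c > 0" "\<And>x. c * (norm x)\<^sup>2 \<le> x \<bullet> H x"
    and x0: "x0 \<in> interior S" and R: "R > 0" and e: "e > 0"
  obtains K \<delta> s0 where "finite K" "\<delta> > 0" "s0 > 0"
    "\<And>s f v. 0 < s \<Longrightarrow> s < s0 \<Longrightarrow> norm v \<le> R \<Longrightarrow> convex_on S f \<Longrightarrow>
       (\<And>u. u \<in> K \<Longrightarrow> \<bar>(f (x0 + s *\<^sub>R u) - f x0) / s\<^sup>2 + H v \<bullet> u - (u \<bullet> H u) / 2\<bar> \<le> \<delta>) \<Longrightarrow>
       (\<exists>x. is_arg_min f (\<lambda>x. x \<in> S) x) \<and>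
       (\<forall>x. is_arg_min f (\<lambda>x. x \<in> S) x \<longrightarrow> norm ((x - x0) /\<^sub>R s - v) < e)"
proof -
  define q where "q = (\<lambda>u. (u \<bullet> H u) / 2)"
  have q: "continuous_on UNIV q"
    unfolding q_def divide_inverse
    by (intro continuous_intros linear_continuous_on linear_conv_bounded_linear[THEN iffD1] lin)
  have "c * e\<^sup>2 / 8 > 0" using c e by simp
  then obtain K \<delta> where K: "finite K" "\<delta> > 0"
    "\<And>S g u. convex_on S g \<Longrightarrow> K \<subseteq> S \<Longrightarrow> (\<And>k. k \<in> K \<Longrightarrow> \<bar>g k - q k\<bar> \<le> \<delta>) \<Longrightarrow> norm u \<le> R + e \<Longrightarrow>
        \<bar>g u - q u\<bar> \<le> c * e\<^sup>2 / 8"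
    using convex_uniform_of_net[OF q, of "R + e" "c * e\<^sup>2 / 8"] R e by (metis add_pos_pos)
  obtain \<rho> where \<rho>: "\<rho> > 0" "ball x0 \<rho> \<subseteq> S" "ball x0 \<rho> \<subseteq> interior S"
    using x0 by (meson interior_subset open_contains_ball open_interior order_trans)
  obtain b where b: "b > 0" "\<And>k. k \<in> K \<Longrightarrow> norm k \<le> b"
    using finite_imp_bounded[OF K(1)] unfolding bounded_pos by blast
  define s0 where "s0 = \<rho> / (b + R + e)"
  have s0: "s0 > 0" using \<rho> b R e by (simp add: s0_def)
  show thesis
  proof (rule that[OF K(1,2) s0])
    fix s f v
    assume s: "0 < s" "s < s0" and v: "norm v \<le> R" and f: "convex_on S f"
      and cl: "\<And>u. u \<in> K \<Longrightarrow> \<bar>(f (x0 + s *\<^sub>R u) - f x0) / s\<^sup>2 + H v \<bullet> u - (u \<bullet> H u) / 2\<bar> \<le> \<delta>"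
    have inb: "x0 + s *\<^sub>R u \<in> ball x0 \<rho>" if "norm u \<le> b + R + e" for u
    proof -
      have "s * norm u \<le> s * (b + R + e)" using that s by (intro mult_left_mono) auto
      also have "\<dots> < \<rho>" using s b R e by (simp add: s0_def pos_less_divide_eq)
      finally show ?thesis using s by (simp add: dist_norm)
    qed
    define g where "g = (\<lambda>u. (f (x0 + s *\<^sub>R u) - f x0) / s\<^sup>2 + H v \<bullet> u)"
    define S' where "S' = {u. x0 + s *\<^sub>R u \<in> S}"
    have S': "u \<in> S'" if "norm u \<le> b + R + e" for u
      using inb[OF that] \<rho> by (auto simp: S'_def)
    have cS: "convex S" using f by (rule convex_on_imp_convex)
    have aff: "x0 + s *\<^sub>R ((1 - t) *\<^sub>R x + t *\<^sub>R y) = (1 - t) *\<^sub>R (x0 + s *\<^sub>R x) + t *\<^sub>R (x0 + s *\<^sub>R y)" for t x y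
      by (simp add: algebra_simps)
    have "convex_on S' g"
    proof (rule convex_onI)
      show "convex S'"
        unfolding convex_alt S'_def using cS aff by (auto simp: convex_alt)
      fix t :: real and x y assume t: "0 < t" "t < 1" and xy: "x \<in> S'" "y \<in> S'"
      have "f (x0 + s *\<^sub>R ((1 - t) *\<^sub>R x + t *\<^sub>R y)) \<le> (1 - t) * f (x0 + s *\<^sub>R x) + t * f (x0 + s *\<^sub>R y)"
        unfolding aff using t xy by (intro convex_onD[OF f]) (auto simp: S'_def)
      then have "(f (x0 + s *\<^sub>R ((1 - t) *\<^sub>R x + t *\<^sub>R y)) - f x0) / s\<^sup>2
          \<le> ((1 - t) * (f (x0 + s *\<^sub>R x) - f x0) + t * (f (x0 + s *\<^sub>R y) - f x0)) / s\<^sup>2"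
        by (intro divide_right_mono) (auto simp: algebra_simps)
      then show "g ((1 - t) *\<^sub>R x + t *\<^sub>R y) \<le> (1 - t) * g x + t * g y"
        unfolding g_def by (simp add: inner_simps algebra_simps add_divide_distrib diff_divide_distrib)
    qed
    moreover have "K \<subseteq> S'" using b R e by (intro subsetI S') fastforce
    ultimately have close: "\<bar>g u - q u\<bar> \<le> c * e\<^sup>2 / 8" if "norm u \<le> R + e" for u
      using K(3)[of S' g u] cl that by (auto simp: g_def q_def)
    have f_g: "f (x0 + s *\<^sub>R u) = f x0 + s\<^sup>2 * (g u - H v \<bullet> u)" for u
      using s by (simp add: g_def field_simps)
    have sub: "cball (x0 + s *\<^sub>R v) (s * e) \<subseteq> ball x0 \<rho>"
    proof
      fix y assume y: "y \<in> cball (x0 + s *\<^sub>R v) (s * e)"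
      define u where "u = (y - x0) /\<^sub>R s"
      have yu: "y = x0 + s *\<^sub>R u" using s by (simp add: u_def)
      have "dist (x0 + s *\<^sub>R v) y = s * norm (u - v)"
        unfolding yu dist_norm using s by (simp add: norm_minus_commute flip: scaleR_diff_right)
      then have "norm (u - v) \<le> e" using y s by simp
      then have "norm u \<le> R + e" using v norm_triangle_ineq[of "u - v" v] by simp
      then show "y \<in> ball x0 \<rho>" unfolding yu using b by (intro inb) auto
    qed
    have cont: "continuous_on (cball (x0 + s *\<^sub>R v) (s * e)) f"
      by (rule continuous_on_subset[OF convex_on_continuous[OF open_interior convex_on_subset[OF f interior_subset]]])
        (use sub \<rho> cS in auto)
    have sphere: "f (x0 + s *\<^sub>R v) < f y" if "dist (x0 + s *\<^sub>R v) y = s * e" for y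
    proof -
      define u where "u = (y - x0) /\<^sub>R s"
      have yu: "y = x0 + s *\<^sub>R u" using s by (simp add: u_def)
      have "dist (x0 + s *\<^sub>R v) y = s * norm (u - v)"
        unfolding yu dist_norm using s by (simp add: norm_minus_commute flip: scaleR_diff_right)
      then have uv: "norm (u - v) = e" using that s by simp
      then have u: "norm u \<le> R + e" using v norm_triangle_ineq[of "u - v" v] by simp
      \<comment> \<open>completing the square needs the symmetry of \<open>H\<close>\<close>
      have "q u - H v \<bullet> u - (q v - H v \<bullet> v) = ((u - v) \<bullet> H (u - v)) / 2"
        unfolding q_def using sym[of v u]
        by (simp add: linear_diff[OF lin] inner_simps inner_commute field_simps)
      also have "\<dots> \<ge> c * e\<^sup>2 / 2" using c(2)[of "u - v"] uv by simp
      finally have "q u - H v \<bullet> u - (q v - H v \<bullet> v) \<ge> c * e\<^sup>2 / 2" .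
      moreover have "c * e\<^sup>2 > 0" using c e by simp
      ultimately have "g v - H v \<bullet> v < g u - H v \<bullet> u"
        using close[OF u] close[OF order_trans[OF v]] e by linarith
      then show ?thesis unfolding yu f_g using s by simp
    qed
    have cb: "cball (x0 + s *\<^sub>R v) (s * e) \<subseteq> S" using sub \<rho> by blast
    have se: "s * e > 0" using s e by simp
    have "norm ((x - x0) /\<^sub>R s - v) < e" if "is_arg_min f (\<lambda>x. x \<in> S) x" for x
    proof -
      have "norm (x - (x0 + s *\<^sub>R v)) < s * e"
        using convex_minimizers_in_ball(2)[OF f se cb cont sphere that] by (simp add: dist_norm norm_minus_commute)
      moreover have "x - (x0 + s *\<^sub>R v) = s *\<^sub>R ((x - x0) /\<^sub>R s - v)" using s by (simp add: algebra_simps)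
      ultimately show ?thesis using s by (simp only: norm_scaleR) simp
    qed
    then show "(\<exists>x. is_arg_min f (\<lambda>x. x \<in> S) x) \<and>
       (\<forall>x. is_arg_min f (\<lambda>x. x \<in> S) x \<longrightarrow> norm ((x - x0) /\<^sub>R s - v) < e)"
      using convex_minimizers_in_ball(1)[OF f se cb cont sphere] by blast
  qed
qed

section \<open>Differentiability of convex functions\<close>

lemma directional_remainder_tendsto:
  fixes f :: "'a::real_inner \<Rightarrow> real"
  assumes d: "(f has_derivative (\<lambda>h. g \<bullet> h)) (at x)"
  shows "((\<lambda>s. (f (x + s *\<^sub>R u) - f x - s * (g \<bullet> u)) / s) \<longlongrightarrow> 0) (at_right 0)"
proof -
  have "((\<lambda>s. f (x + s *\<^sub>R u)) has_derivative (\<lambda>s. g \<bullet> (s *\<^sub>R u))) (at 0)"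
  proof (rule has_derivative_compose[of "\<lambda>s. x + s *\<^sub>R u" _ 0 UNIV f])
    show "((\<lambda>s. x + s *\<^sub>R u) has_derivative (\<lambda>s. s *\<^sub>R u)) (at 0)" by (auto intro!: derivative_eq_intros)
  qed (use d in simp)
  then have "((\<lambda>s. f (x + s *\<^sub>R u)) has_real_derivative g \<bullet> u) (at 0)"
    by (simp add: has_field_derivative_def mult_commute_abs)
  then have "((\<lambda>s. (f (x + s *\<^sub>R u) - f x) / s) \<longlongrightarrow> g \<bullet> u) (at_right 0)"
    unfolding has_field_derivative_iff by (auto intro: tendsto_mono[OF at_le])
  then have "((\<lambda>s. (f (x + s *\<^sub>R u) - f x) / s - g \<bullet> u) \<longlongrightarrow> 0) (at_right 0)"
    using LIM_zero by blast
  moreover have "\<forall>\<^sub>F s in at_right 0. (f (x + s *\<^sub>R u) - f x) / s - g \<bullet> u = (f (x + s *\<^sub>R u) - f x - s * (g \<bullet> u)) / s"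
    using eventually_at_right_less[of "0::real"] by eventually_elim (simp add: field_simps)
  ultimately show ?thesis by (rule Lim_transform_eventually)
qed

lemma convex_difference_quotient_mono:
  fixes f :: "'a::real_inner \<Rightarrow> real"
  assumes f: "convex_on S f" and x: "x \<in> S" and y: "x + s' *\<^sub>R u \<in> S" and s: "0 < s" "s \<le> s'"
  shows "(f (x + s *\<^sub>R u) - f x - s * (g \<bullet> u)) / s \<le> (f (x + s' *\<^sub>R u) - f x - s' * (g \<bullet> u)) / s'"
proof -
  define r where "r = s / s'"
  have r: "0 \<le> r" "r \<le> 1" using s by (auto simp: r_def)
  have "x + s *\<^sub>R u = (1 - r) *\<^sub>R x + r *\<^sub>R (x + s' *\<^sub>R u)"
    using s by (simp add: r_def algebra_simps)
  then have "f (x + s *\<^sub>R u) \<le> (1 - r) * f x + r * f (x + s' *\<^sub>R u)"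
    using convex_onD[OF f, of r x "x + s' *\<^sub>R u"] r x y by simp
  then have "f (x + s *\<^sub>R u) - f x \<le> r * (f (x + s' *\<^sub>R u) - f x)" by (simp add: algebra_simps)
  then have "(f (x + s *\<^sub>R u) - f x) / s \<le> (r * (f (x + s' *\<^sub>R u) - f x)) / s"
    using s by (simp add: divide_right_mono)
  also have "\<dots> = (f (x + s' *\<^sub>R u) - f x) / s'" using s by (simp add: r_def)
  finally show ?thesis using s by (simp add: diff_divide_distrib)
qed

lemma convex_on_gradient_ineq:
  fixes f :: "'a::real_inner \<Rightarrow> real"
  assumes f: "convex_on S f" and x: "x \<in> interior S" and y: "y \<in> S"
    and d: "(f has_derivative (\<lambda>h. g \<bullet> h)) (at x)"
  shows "f x + g \<bullet> (y - x) \<le> f y"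
proof -
  have xS: "x \<in> S" using x interior_subset by blast
  have "\<forall>\<^sub>F s in at_right 0. (f (x + s *\<^sub>R (y - x)) - f x - s * (g \<bullet> (y - x))) / s
      \<le> (f (x + 1 *\<^sub>R (y - x)) - f x - 1 * (g \<bullet> (y - x))) / 1"
    using eventually_at_right_real[OF zero_less_one[where 'a=real]]
    by eventually_elim (use y in \<open>intro convex_difference_quotient_mono[OF f xS], auto\<close>)
  from tendsto_upperbound[OF directional_remainder_tendsto[OF d] this] show ?thesis by simp
qed

text \<open>
  A steep paraboloid centred at \<open>x0\<close> touches \<open>f\<close> from above at a point \<open>x\<close> near \<open>x0\<close>, namely where
  $k\,|x - x_0|^2 - f(x)$ is minimal. At \<open>x\<close> this gives a quadratic upper bound for the
  remainder of the linear approximation; by midpoint convexity at $x \pm h$ the same bound holds from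
  below.
\<close>

lemma convex_differentiable_dense:
  fixes f :: "'a::euclidean_space \<Rightarrow> real"
  assumes f: "convex_on S f" and x0: "x0 \<in> interior S" and e: "e > 0"
  obtains x g where "x \<in> interior S" "dist x0 x < e" "(f has_derivative (\<lambda>h. g \<bullet> h)) (at x)"
proof -
  obtain r where r: "r > 0" "cball x0 r \<subseteq> interior S"
    using x0 open_contains_cball open_interior by blast
  define d where "d = min r (e / 2)"
  have d: "d > 0" "d < e" "cball x0 d \<subseteq> interior S" using r e by (auto simp: d_def)
  have cf: "continuous_on (cball x0 d) f"
    by (rule continuous_on_subset[OF convex_on_continuous[OF open_interior convex_on_subset[OF f interior_subset]] d(3)])
       (use convex_on_imp_convex[OF f] in auto)
  obtain B where "\<forall>v\<in>f ` cball x0 d. norm v \<le> B"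
    using compact_imp_bounded[OF compact_continuous_image[OF cf compact_cball]]
    unfolding bounded_iff by blast
  then have B: "\<bar>f x\<bar> \<le> B" if "x \<in> cball x0 d" for x using that by simp
  \<comment> \<open>steep enough that on the sphere of radius \<open>d\<close> the paraboloid outweighs the oscillation of \<open>f\<close>\<close>
  define k where "k = (2 * B + 1) / d\<^sup>2"
  have "continuous_on (cball x0 d) (\<lambda>x. k * (norm (x - x0))\<^sup>2 - f x)"
    by (intro continuous_intros cf)
  then obtain x where x: "x \<in> cball x0 d"
    "\<And>y. y \<in> cball x0 d \<Longrightarrow> k * (norm (x - x0))\<^sup>2 - f x \<le> k * (norm (y - x0))\<^sup>2 - f y"
    using continuous_attains_inf[OF compact_cball, of x0 d "\<lambda>x. k * (norm (x - x0))\<^sup>2 - f x"] d(1)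
    by (metis centre_in_cball empty_iff less_imp_le)
  have x0d: "x0 \<in> cball x0 d" using d by simp
  have "k * (norm (x - x0))\<^sup>2 \<le> 2 * B"
    using x(2)[OF x0d] B[OF x0d] B[OF x(1)] by simp
  also have "\<dots> < k * d\<^sup>2" using d by (simp add: k_def)
  finally have kn: "k * (norm (x - x0))\<^sup>2 < k * d\<^sup>2" .
  have "0 \<le> B" using B[OF x0d] by simp
  then have k0: "k > 0" using d by (simp add: k_def)
  have xd: "dist x0 x < d"
    using kn k0 d by (simp add: dist_norm norm_minus_commute power2_less_imp_less)
  have xS: "x \<in> interior S" using x d by auto
  define g where "g = (2 * k) *\<^sub>R (x - x0)"
  have up: "f (x + h) - f x - g \<bullet> h \<le> k * (norm h)\<^sup>2" if "x + h \<in> cball x0 d" for h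
  proof -
    have "(norm (x - x0 + h))\<^sup>2 = (norm (x - x0))\<^sup>2 + 2 * ((x - x0) \<bullet> h) + (norm h)\<^sup>2"
      unfolding power2_norm_eq_inner inner_add_left inner_add_right by (simp add: inner_commute)
    moreover have "x - x0 + h = x + h - x0" by simp
    ultimately have sq: "(norm (x + h - x0))\<^sup>2 = (norm (x - x0))\<^sup>2 + 2 * ((x - x0) \<bullet> h) + (norm h)\<^sup>2" by simp
    have "k * (norm (x + h - x0))\<^sup>2 = k * (norm (x - x0))\<^sup>2 + g \<bullet> h + k * (norm h)\<^sup>2"
      unfolding sq g_def inner_scaleR_left by (simp only: distrib_left mult.assoc mult.left_commute)
    with x(2)[OF that] show ?thesis by simp
  qed
  define \<rho> where "\<rho> = d - dist x0 x"
  have \<rho>: "\<rho> > 0" using xd by (simp add: \<rho>_def)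
  have two_sided: "\<bar>f (x + h) - f x - g \<bullet> h\<bar> \<le> k * (norm h)\<^sup>2" if "norm h < \<rho>" for h
  proof -
    have near: "x + h' \<in> cball x0 d" if "norm h' = norm h" for h'
      using dist_triangle[of x0 "x + h'" x] that \<open>norm h < \<rho>\<close> by (simp add: \<rho>_def dist_norm)
    have in_d: "x + h \<in> cball x0 d" "x + - h \<in> cball x0 d"
      using near[of h] near[of "- h"] by simp_all
    then have in_S: "x + h \<in> S" "x + - h \<in> S" using d(3) interior_subset by blast+
    have "f ((1 - 1/2) *\<^sub>R (x + h) + (1/2) *\<^sub>R (x + - h)) \<le> (1 - 1/2) * f (x + h) + (1/2) * f (x + - h)"
      using in_S by (intro convex_onD[OF f]) auto
    moreover have "(1 - 1/2) *\<^sub>R (x + h) + (1/2) *\<^sub>R (x + - h) = x"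
      using scaleR_half_double[of x] by (simp add: scaleR_add_right scaleR_diff_right)
    ultimately have "2 * f x \<le> f (x + h) + f (x + - h)" by simp
    then show ?thesis using up[OF in_d(1)] up[OF in_d(2)] by simp
  qed
  have "(f has_derivative (\<lambda>h. g \<bullet> h)) (at x)"
    unfolding has_derivative_at_alt
  proof (intro conjI allI impI bounded_linear_inner_right)
    fix \<epsilon> :: real assume \<epsilon>: "\<epsilon> > 0"
    show "\<exists>\<delta>>0. \<forall>y. norm (y - x) < \<delta> \<longrightarrow> norm (f y - f x - g \<bullet> (y - x)) \<le> \<epsilon> * norm (y - x)"
    proof (intro exI[of _ "min \<rho> (\<epsilon> / k)"] conjI allI impI)
      fix y assume y: "norm (y - x) < min \<rho> (\<epsilon> / k)"
      have "k * norm (y - x) \<le> \<epsilon>" using y k0 by (simp add: field_simps)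
      then have "k * norm (y - x) * norm (y - x) \<le> \<epsilon> * norm (y - x)" by (rule mult_right_mono) simp
      then show "norm (f y - f x - g \<bullet> (y - x)) \<le> \<epsilon> * norm (y - x)"
        using two_sided[of "y - x"] y by (simp add: power2_eq_square mult.assoc)
    qed (use \<rho> \<epsilon> k0 in simp)
  qed
  then show thesis using that xS xd d by force
qed

text \<open>
  On the dense set where \<open>f\<close> is differentiable, \<open>G\<close> satisfies the subgradient inequality; by
  continuity it does so on \<open>U\<close>. A convex function with a continuous selection of subgradients is
  differentiable: two subgradient inequalities bound the remainder at \<open>y\<close> by
  $(G(y) - G(x)) \cdot (y - x)$. For the penalized risk this excludes kinks of the penalty near
  $\theta_0$.
\<close>

lemma convex_gradient_extends:
  fixes f :: "'a::euclidean_space \<Rightarrow> real"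
  assumes f: "convex_on S f" and U: "open U" "U \<subseteq> S" and G: "continuous_on U G"
    and grad: "\<And>x g. x \<in> U \<Longrightarrow> (f has_derivative (\<lambda>h. g \<bullet> h)) (at x) \<Longrightarrow> g = G x"
    and x: "x \<in> U"
  shows "(f has_derivative (\<lambda>h. G x \<bullet> h)) (at x)"
proof -
  have US: "U \<subseteq> interior S" using U by (simp add: interior_maximal)
  have cf: "continuous_on U f"
    by (rule continuous_on_subset[OF convex_on_continuous[OF open_interior convex_on_subset[OF f interior_subset]] US])
       (use convex_on_imp_convex[OF f] in auto)
  have subgrad: "f x + G x \<bullet> (y - x) \<le> f y" if x: "x \<in> U" and y: "y \<in> S" for x y
  proof (rule ccontr)
    assume neg: "\<not> ?thesis"
    have "continuous_on U (\<lambda>z. f z + G z \<bullet> (y - z))" by (intro continuous_intros cf G)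
    then have "open (U \<inter> (\<lambda>z. f z + G z \<bullet> (y - z)) -` {f y<..})"
      by (intro continuous_open_preimage U open_greaterThan)
    then obtain e where e: "e > 0" "ball x e \<subseteq> U \<inter> (\<lambda>z. f z + G z \<bullet> (y - z)) -` {f y<..}"
      using neg x unfolding open_contains_ball by force
    obtain z g where z: "z \<in> interior S" "dist x z < e" "(f has_derivative (\<lambda>h. g \<bullet> h)) (at z)"
      using convex_differentiable_dense[OF f _ e(1), of x] US x by blast
    then have "z \<in> U" "f y < f z + G z \<bullet> (y - z)" using e by auto
    then show False
      using convex_on_gradient_ineq[OF f z(1) y z(3)] grad[OF _ z(3)] by simp
  qed
  show ?thesis
    unfolding has_derivative_at_alt
  proof (intro conjI allI impI bounded_linear_inner_right)
    fix \<epsilon> :: real assume \<epsilon>: "\<epsilon> > 0"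
    obtain d where d: "d > 0" "\<And>y. y \<in> U \<Longrightarrow> dist y x < d \<Longrightarrow> dist (G y) (G x) < \<epsilon>"
      using G x \<epsilon> unfolding continuous_on_iff by metis
    obtain r where r: "r > 0" "ball x r \<subseteq> U" using U x open_contains_ball by blast
    show "\<exists>\<delta>>0. \<forall>y. norm (y - x) < \<delta> \<longrightarrow> norm (f y - f x - G x \<bullet> (y - x)) \<le> \<epsilon> * norm (y - x)"
    proof (intro exI[of _ "min d r"] conjI allI impI)
      fix y assume y: "norm (y - x) < min d r"
      then have yU: "y \<in> U" using r by (auto simp: dist_norm norm_minus_commute)
      have "f y - f x - G x \<bullet> (y - x) \<le> (G y - G x) \<bullet> (y - x)"
        using subgrad[OF yU, of x] x U by (simp add: inner_simps subset_iff)
      also have "\<dots> \<le> norm (G y - G x) * norm (y - x)" by (rule norm_cauchy_schwarz)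
      also have "\<dots> \<le> \<epsilon> * norm (y - x)"
        using d(2)[OF yU] y by (intro mult_right_mono) (auto simp: dist_norm)
      finally show "norm (f y - f x - G x \<bullet> (y - x)) \<le> \<epsilon> * norm (y - x)"
        using subgrad[OF x, of y] yU U by (auto simp: subset_iff)
    qed (use d r in simp)
  qed
qed

text \<open>
  The gradient is assumed differentiable only at \<open>x0\<close>, so second-order Taylor formulas are not
  available; instead the mean value theorem is applied along the segment from $x_0 + su$ to
  $x_0 + s(u+v)$ to the difference of \<open>f\<close> and its expected expansion. The case \<open>u = 0\<close> is the
  quadratic expansion at \<open>x0\<close>; general \<open>u\<close> yields the symmetry of \<open>H\<close>.
\<close>

lemma second_difference_expansion:
  fixes f :: "'a::euclidean_space \<Rightarrow> real"
  assumes U: "open U" "x0 \<in> U" and f: "\<And>x. x \<in> U \<Longrightarrow> (f has_derivative (\<lambda>h. G x \<bullet> h)) (at x)"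
    and G: "(G has_derivative H) (at x0)"
  shows "((\<lambda>s. (f (x0 + s *\<^sub>R (u + v)) - f (x0 + s *\<^sub>R u) - s * (G x0 \<bullet> v)) / s\<^sup>2)
            \<longlongrightarrow> H u \<bullet> v + (H v \<bullet> v) / 2) (at_right 0)"
proof (rule tendstoI)
  fix \<epsilon> :: real assume \<epsilon>: "\<epsilon> > 0"
  have lin: "linear H" using G has_derivative_linear by blast
  define A where "A = norm u + norm v + 1"
  define e where "e = \<epsilon> / (2 * A * A)"
  have A: "A \<ge> 1" by (simp add: A_def)
  have e: "e > 0" using \<epsilon> A by (simp add: e_def)
  obtain d1 where d1: "d1 > 0"
    "\<And>y. norm (y - x0) < d1 \<Longrightarrow> norm (G y - G x0 - H (y - x0)) \<le> e * norm (y - x0)"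
    using G e unfolding has_derivative_at_alt by metis
  obtain d2 where d2: "d2 > 0" "ball x0 d2 \<subseteq> U" using U open_contains_ball by blast
  have "\<forall>\<^sub>F s in at_right 0. s < min d1 d2 / A \<and> s > (0::real)"
    using d1 d2 A by (intro eventually_conj eventually_at_right_less eventually_at_rightI[of 0 "min d1 d2 / A"]) auto
  then show "\<forall>\<^sub>F s in at_right 0. dist ((f (x0 + s *\<^sub>R (u + v)) - f (x0 + s *\<^sub>R u) - s * (G x0 \<bullet> v)) / s\<^sup>2)
      (H u \<bullet> v + (H v \<bullet> v) / 2) < \<epsilon>"
  proof eventually_elim
    case (elim s)
    define w where "w = (\<lambda>t::real. x0 + s *\<^sub>R (u + t *\<^sub>R v))"
    have wn: "norm (w t - x0) \<le> s * A" "norm (w t - x0) < d1" "w t \<in> U" if t: "0 \<le> t" "t \<le> 1" for t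
    proof -
      have "norm (u + t *\<^sub>R v) \<le> norm u + norm (t *\<^sub>R v)" by (rule norm_triangle_ineq)
      also have "norm (t *\<^sub>R v) \<le> norm v" using t by (simp add: mult_left_le_one_le)
      finally have "norm (u + t *\<^sub>R v) \<le> A" by (simp add: A_def)
      then show *: "norm (w t - x0) \<le> s * A" using elim by (simp add: w_def)
      have "s * A < min d1 d2" using elim A by (simp add: field_simps)
      with * show "norm (w t - x0) < d1" "w t \<in> U"
        using d2 by (auto simp: dist_norm norm_minus_commute)
    qed
    define \<Gamma> where "\<Gamma> = (\<lambda>t. f (w t) - s * t * (G x0 \<bullet> v) - s\<^sup>2 * (t * (H u \<bullet> v) + t\<^sup>2 * (H v \<bullet> v) / 2))"
    have deriv: "(\<Gamma> has_real_derivative s * ((G (w t) - G x0 - H (w t - x0)) \<bullet> v)) (at t)"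
      if t: "0 \<le> t" "t \<le> 1" for t
    proof -
      have "((\<lambda>t. f (w t)) has_derivative (\<lambda>h. G (w t) \<bullet> (s *\<^sub>R h *\<^sub>R v))) (at t)"
      proof (rule has_derivative_compose[of w _ t UNIV f])
        show "(w has_derivative (\<lambda>h. s *\<^sub>R h *\<^sub>R v)) (at t)"
          unfolding w_def by (auto intro!: derivative_eq_intros)
      qed (rule f[OF wn(3)[OF t]])
      then have "((\<lambda>t. f (w t)) has_real_derivative s * (G (w t) \<bullet> v)) (at t)"
        by (simp add: has_field_derivative_def mult_commute_abs mult.assoc mult.left_commute)
      moreover have "H (w t - x0) = s *\<^sub>R (H u + t *\<^sub>R H v)"
        by (simp add: w_def linear_scale[OF lin] linear_add[OF lin])
      ultimately show ?thesis
        unfolding \<Gamma>_def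
        by (auto intro!: derivative_eq_intros simp: inner_simps power2_eq_square algebra_simps)
    qed
    have "\<exists>t. 0 < t \<and> t < 1 \<and> \<Gamma> 1 - \<Gamma> 0 = (1 - 0) * (s * ((G (w t) - G x0 - H (w t - x0)) \<bullet> v))"
      by (rule MVT2) (use deriv in auto)
    then obtain t where t: "0 < t" "t < 1" "\<Gamma> 1 - \<Gamma> 0 = s * ((G (w t) - G x0 - H (w t - x0)) \<bullet> v)"
      by auto
    define D where "D = norm (G (w t) - G x0 - H (w t - x0))"
    have "D \<le> e * norm (w t - x0)" unfolding D_def using t by (intro d1(2) wn(2)) auto
    also have "\<dots> \<le> e * (s * A)" using t e by (intro mult_left_mono wn(1)) auto
    finally have D: "D \<le> e * (s * A)" .
    have "\<bar>\<Gamma> 1 - \<Gamma> 0\<bar> = s * \<bar>(G (w t) - G x0 - H (w t - x0)) \<bullet> v\<bar>"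
      unfolding t(3) abs_mult using elim by simp
    also have "\<dots> \<le> s * (D * norm v)"
      unfolding D_def using elim by (intro mult_left_mono Cauchy_Schwarz_ineq2) auto
    also have "\<dots> \<le> s * ((e * (s * A)) * A)"
      using elim A e D by (intro mult_left_mono mult_mono) (auto simp: A_def)
    also have "\<dots> = \<epsilon> / 2 * s\<^sup>2" using A by (simp add: e_def power2_eq_square)
    also have "\<dots> < \<epsilon> * s\<^sup>2" using \<epsilon> elim by simp
    finally have lt: "\<bar>\<Gamma> 1 - \<Gamma> 0\<bar> < \<epsilon> * s\<^sup>2" .
    have "\<Gamma> 1 - \<Gamma> 0 = f (x0 + s *\<^sub>R (u + v)) - f (x0 + s *\<^sub>R u) - s * (G x0 \<bullet> v) - s\<^sup>2 * (H u \<bullet> v + (H v \<bullet> v) / 2)"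
      by (simp add: \<Gamma>_def w_def)
    then have "(f (x0 + s *\<^sub>R (u + v)) - f (x0 + s *\<^sub>R u) - s * (G x0 \<bullet> v)) / s\<^sup>2 - (H u \<bullet> v + (H v \<bullet> v) / 2)
        = (\<Gamma> 1 - \<Gamma> 0) / s\<^sup>2" using elim by (simp only: diff_divide_distrib) simp
    then show ?case using lt elim by (simp add: dist_real_def pos_divide_less_eq)
  qed
qed

text \<open>
  The increment from $x_0$ to $x_0 + s(u+v)$ is expanded directly and via $x_0 + su$;
  comparing the second-order terms gives $Hu \cdot v = (u \cdot Hv + v \cdot Hu)/2$.
\<close>

lemma symmetric_of_gradient_derivative:
  fixes f :: "'a::euclidean_space \<Rightarrow> real"
  assumes U: "open U" "x0 \<in> U" and f: "\<And>x. x \<in> U \<Longrightarrow> (f has_derivative (\<lambda>h. G x \<bullet> h)) (at x)"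
    and G: "(G has_derivative H) (at x0)"
  shows "H u \<bullet> v = u \<bullet> H v"
proof -
  have lin: "linear H" using G has_derivative_linear by blast
  define q where "q = (\<lambda>u v s. (f (x0 + s *\<^sub>R (u + v)) - f (x0 + s *\<^sub>R u) - s * (G x0 \<bullet> v)) / s\<^sup>2)"
  have q: "((\<lambda>s. q u v s) \<longlongrightarrow> H u \<bullet> v + (H v \<bullet> v) / 2) (at_right 0)" for u v
    unfolding q_def by (rule second_difference_expansion[OF U f G])
  have "((\<lambda>s. q 0 (u + v) s - q 0 u s) \<longlongrightarrow> H 0 \<bullet> (u + v) + (H (u + v) \<bullet> (u + v)) / 2 - (H 0 \<bullet> u + (H u \<bullet> u) / 2)) (at_right 0)"
    by (intro tendsto_intros q)
  moreover have "(\<lambda>s. q 0 (u + v) s - q 0 u s) = q u v"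
    by (rule ext) (simp add: q_def inner_simps diff_divide_distrib add_divide_distrib algebra_simps)
  ultimately have "H u \<bullet> v + (H v \<bullet> v) / 2 = H 0 \<bullet> (u + v) + (H (u + v) \<bullet> (u + v)) / 2 - (H 0 \<bullet> u + (H u \<bullet> u) / 2)"
    using tendsto_unique[OF _ q[of u v]] by fastforce
  then show ?thesis
    using linear_0[OF lin] by (simp add: linear_add[OF lin] inner_simps inner_commute field_simps)
qed

lemma positive_definite_of_injective:
  fixes H :: "'a::euclidean_space \<Rightarrow> 'a"
  assumes lin: "linear H" and inj: "inj H" and sym: "\<And>x y. H x \<bullet> y = x \<bullet> H y"
    and nonneg: "\<And>x. 0 \<le> x \<bullet> H x"
  obtains c where "c > 0" "\<And>x. c * (norm x)\<^sup>2 \<le> x \<bullet> H x"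
proof -
  have pos: "x \<bullet> H x > 0" if "x \<noteq> 0" for x
  proof (rule ccontr)
    assume "\<not> ?thesis"
    then have 0: "x \<bullet> H x = 0" using nonneg[of x] by simp
    have hx: "H x \<noteq> 0" using inj that linear_injective_0[OF lin] by blast
    \<comment> \<open>moving from \<open>x\<close> a little against \<open>H x\<close> would make the quadratic form negative\<close>
    define a where "a = H x \<bullet> H x"
    define b where "b = H x \<bullet> H (H x)"
    have a: "a > 0" using hx by (simp add: a_def)
    have b: "b \<ge> 0" unfolding b_def by (rule nonneg)
    define t where "t = a / (b + 1)"
    have t: "t > 0" using a b by (simp add: t_def)
    have "0 \<le> (x - t *\<^sub>R H x) \<bullet> H (x - t *\<^sub>R H x)" by (rule nonneg)
    also have "\<dots> = t * (t * b - 2 * a)"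
      using 0 sym[of x "H x"]
      by (simp add: linear_diff[OF lin] linear_scale[OF lin] inner_simps inner_commute a_def b_def algebra_simps)
    finally have "2 * a \<le> t * b" using t by (simp add: zero_le_mult_iff)
    also have "t * b \<le> a" unfolding t_def using a b by (simp add: field_simps)
    finally show False using a by simp
  qed
  have cont: "continuous_on (sphere 0 1) (\<lambda>x. x \<bullet> H x)"
    by (intro continuous_intros linear_continuous_on linear_conv_bounded_linear[THEN iffD1] lin)
  have ne: "sphere (0::'a) 1 \<noteq> {}" by simp
  obtain x where x: "x \<in> sphere 0 1" "\<And>y. y \<in> sphere 0 1 \<Longrightarrow> x \<bullet> H x \<le> y \<bullet> H y"
    using continuous_attains_inf[OF compact_sphere ne cont] by auto
  show thesis
  proof (rule that)
    show "x \<bullet> H x > 0" using x(1) by (intro pos) auto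
    fix y :: 'a
    show "(x \<bullet> H x) * (norm y)\<^sup>2 \<le> y \<bullet> H y"
    proof (cases "y = 0")
      case False
      then have "x \<bullet> H x \<le> (y /\<^sub>R norm y) \<bullet> H (y /\<^sub>R norm y)" by (intro x(2)) simp
      then show ?thesis using False by (simp add: linear_scale[OF lin] field_simps power2_eq_square)
    qed simp
  qed
qed

lemma linear_inv_of_bij:
  assumes f: "linear f" "bij f"
  shows "linear (inv f)"
proof (rule linearI)
  have fi: "f (inv f x) = x" for x using f(2) by (simp add: bij_is_surj surj_f_inv_f)
  show "inv f (x + y) = inv f x + inv f y" for x y
    by (rule inv_f_eq[OF bij_is_inj[OF f(2)]]) (simp add: linear_add[OF f(1)] fi)
  show "inv f (r *\<^sub>R x) = r *\<^sub>R inv f x" for r x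
    by (rule inv_f_eq[OF bij_is_inj[OF f(2)]]) (simp add: linear_scale[OF f(1)] fi)
qed

section \<open>Integrals with respect to samples, contaminated laws and parametrized losses\<close>

text \<open>
  Bienayme's identity: the mixed terms of the square vanish by independence and centring.
\<close>

lemma (in prob_space) expectation_square_sum_independent:
  fixes Z :: "nat \<Rightarrow> 'a \<Rightarrow> 'b" and h :: "'b \<Rightarrow> real"
  assumes indep: "indep_vars (\<lambda>i. N) Z UNIV" and distr: "\<And>i. distr M N (Z i) = F"
    and h[measurable]: "h \<in> borel_measurable N"
    and h2: "integrable F (\<lambda>z. (h z)\<^sup>2)" and h0: "(\<integral>z. h z \<partial>F) = 0"
  shows "integrable M (\<lambda>\<omega>. (\<Sum>i<n. h (Z i \<omega>))\<^sup>2)"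
    and "expectation (\<lambda>\<omega>. (\<Sum>i<n. h (Z i \<omega>))\<^sup>2) = real n * (\<integral>z. (h z)\<^sup>2 \<partial>F)"
proof -
  have Z[measurable]: "Z i \<in> measurable M N" for i using indep by (simp add: indep_vars_def2)
  have sq: "integrable M (\<lambda>\<omega>. (h (Z i \<omega>))\<^sup>2)" "expectation (\<lambda>\<omega>. (h (Z i \<omega>))\<^sup>2) = (\<integral>z. (h z)\<^sup>2 \<partial>F)" for i
    using h2 unfolding distr[of i, symmetric] by (auto simp: integrable_distr_eq integral_distr)
  have int: "integrable M (\<lambda>\<omega>. h (Z i \<omega>))" for i
    by (rule square_integrable_imp_integrable[OF _ sq(1)]) simp
  have E0: "expectation (\<lambda>\<omega>. h (Z i \<omega>)) = 0" for i
    using h0 unfolding distr[of i, symmetric] by (simp add: integral_distr)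
  have cross: "integrable M (\<lambda>\<omega>. h (Z i \<omega>) * h (Z j \<omega>))"
       "expectation (\<lambda>\<omega>. h (Z i \<omega>) * h (Z j \<omega>)) = (if i = j then (\<integral>z. (h z)\<^sup>2 \<partial>F) else 0)" for i j
  proof -
    have "integrable M (\<lambda>\<omega>. h (Z i \<omega>) * h (Z j \<omega>)) \<and>
       expectation (\<lambda>\<omega>. h (Z i \<omega>) * h (Z j \<omega>)) = (if i = j then (\<integral>z. (h z)\<^sup>2 \<partial>F) else 0)"
    proof (cases "i = j")
      case False
      have ind: "indep_vars (\<lambda>i. borel) (\<lambda>i \<omega>. h (Z i \<omega>)) {i, j}"
        by (rule indep_vars_subset[OF indep_vars_compose2[OF indep]]) auto
      show ?thesis
        using indep_vars_integrable[OF _ ind] indep_vars_lebesgue_integral[OF _ ind] int E0 False by simp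
    qed (use sq in \<open>simp add: power2_eq_square\<close>)
    then show "integrable M (\<lambda>\<omega>. h (Z i \<omega>) * h (Z j \<omega>))"
       "expectation (\<lambda>\<omega>. h (Z i \<omega>) * h (Z j \<omega>)) = (if i = j then (\<integral>z. (h z)\<^sup>2 \<partial>F) else 0)" by auto
  qed
  have eq: "(\<lambda>\<omega>. (\<Sum>i<n. h (Z i \<omega>))\<^sup>2) = (\<lambda>\<omega>. \<Sum>i<n. \<Sum>j<n. h (Z i \<omega>) * h (Z j \<omega>))"
    by (simp add: power2_eq_square sum_product)
  show "integrable M (\<lambda>\<omega>. (\<Sum>i<n. h (Z i \<omega>))\<^sup>2)" unfolding eq by (intro Bochner_Integration.integrable_sum cross)
  show "expectation (\<lambda>\<omega>. (\<Sum>i<n. h (Z i \<omega>))\<^sup>2) = real n * (\<integral>z. (h z)\<^sup>2 \<partial>F)"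
    unfolding eq by (simp add: cross)
qed

lemma (in prob_space) Chebyshev_sum_independent:
  fixes Z :: "nat \<Rightarrow> 'a \<Rightarrow> 'b" and h :: "'b \<Rightarrow> real"
  assumes indep: "indep_vars (\<lambda>i. N) Z UNIV" and distr: "\<And>i. distr M N (Z i) = F"
    and h[measurable]: "h \<in> borel_measurable N"
    and h2: "integrable F (\<lambda>z. (h z)\<^sup>2)" and h0: "(\<integral>z. h z \<partial>F) = 0" and a: "a > 0"
  shows "prob {\<omega>\<in>space M. a \<le> \<bar>\<Sum>i<n. h (Z i \<omega>)\<bar>} \<le> real n * (\<integral>z. (h z)\<^sup>2 \<partial>F) / a\<^sup>2"
proof -
  have [measurable]: "Z i \<in> measurable M N" for i using indep by (simp add: indep_vars_def2)
  show ?thesis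
    using second_moment_method[OF _ expectation_square_sum_independent(1)[OF indep distr h h2 h0, of n] a]
    by (simp add: expectation_square_sum_independent(2)[OF indep distr h h2 h0])
qed

lemma mixture_properties:
  fixes P Q :: "'a measure"
  assumes P: "prob_space P" and Q: "prob_space Q" and sets: "sets Q = sets P" and t: "0 \<le> t" "t \<le> 1"
  shows sets_mixture: "sets (mixture t P Q) = sets P"
    and emeasure_mixture: "A \<in> sets P \<Longrightarrow>
      emeasure (mixture t P Q) A = ennreal (1 - t) * emeasure P A + ennreal t * emeasure Q A"
    and prob_space_mixture: "prob_space (mixture t P Q)"
proof -
  show s: "sets (mixture t P Q) = sets P"
    by (simp add: mixture_def)
  have em: "emeasure (mixture t P Q) A = ennreal (1 - t) * emeasure P A + ennreal t * emeasure Q A"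
    if A: "A \<in> sets P" for A
    unfolding mixture_def
  proof (rule emeasure_measure_of_sigma)
    show "sigma_algebra (space P) (sets P)" by (rule sets.sigma_algebra_axioms)
    show "positive (sets P) (\<lambda>A. ennreal (1 - t) * emeasure P A + ennreal t * emeasure Q A)"
      by (simp add: positive_def)
    show "countably_additive (sets P) (\<lambda>A. ennreal (1 - t) * emeasure P A + ennreal t * emeasure Q A)"
    proof (rule countably_additiveI)
      fix B :: "nat \<Rightarrow> 'a set" assume B: "range B \<subseteq> sets P" "disjoint_family B" "\<Union> (range B) \<in> sets P"
      have "(\<Sum>i. emeasure P (B i)) = emeasure P (\<Union> (range B))"
        "(\<Sum>i. emeasure Q (B i)) = emeasure Q (\<Union> (range B))"
        using B sets by (auto intro!: suminf_emeasure)
      then show "(\<Sum>i. ennreal (1 - t) * emeasure P (B i) + ennreal t * emeasure Q (B i))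
          = ennreal (1 - t) * emeasure P (\<Union> (range B)) + ennreal t * emeasure Q (\<Union> (range B))"
        by (simp add: ennreal_suminf_cmult flip: suminf_add)
    qed
  qed fact
  show "A \<in> sets P \<Longrightarrow>
      emeasure (mixture t P Q) A = ennreal (1 - t) * emeasure P A + ennreal t * emeasure Q A" by (rule em)
  have sp: "space (mixture t P Q) = space P" "space Q = space P"
    using s sets by (auto dest: sets_eq_imp_space_eq)
  show "prob_space (mixture t P Q)"
  proof (rule prob_spaceI)
    show "emeasure (mixture t P Q) (space (mixture t P Q)) = 1"
      using em[of "space P"] prob_space.emeasure_space_1[OF P] prob_space.emeasure_space_1[OF Q] t
      by (simp add: sp flip: ennreal_plus)
  qed
qed

lemma nn_integral_mixture:
  assumes P: "prob_space P" and Q: "prob_space Q" and sets: "sets Q = sets P" and t: "0 \<le> t" "t \<le> 1"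
    and f: "f \<in> borel_measurable P"
  shows "nn_integral (mixture t P Q) f = ennreal (1 - t) * nn_integral P f + ennreal t * nn_integral Q f"
proof -
  note m = mixture_properties[OF P Q sets t]
  have meas: "measurable (mixture t P Q) (borel :: ennreal measure) = measurable P borel"
    "measurable Q (borel :: ennreal measure) = measurable P borel"
    using m(1) sets by (auto intro: measurable_cong_sets)
  have sp: "space (mixture t P Q) = space P" "space Q = space P"
    using m(1) sets by (auto dest: sets_eq_imp_space_eq)
  show ?thesis using f
  proof (induction rule: borel_measurable_induct)
    case (cong f g)
    have "nn_integral (mixture t P Q) f = nn_integral (mixture t P Q) g" "nn_integral P f = nn_integral P g" "nn_integral Q f = nn_integral Q g"
      using cong(3) by (intro nn_integral_cong, simp add: sp)+
    with cong show ?case by simp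
  next
    case (set A)
    then show ?case using m sets by simp
  next
    case (mult u c)
    then show ?case using meas by (simp add: nn_integral_cmult distrib_left mult.left_commute)
  next
    case (add u v)
    then show ?case using meas by (simp add: nn_integral_add distrib_left add_ac)
  next
    case (seq U)
    have incU: "incseq U" using seq by blast
    have IH: "nn_integral (mixture t P Q) (U i) = ennreal (1 - t) * nn_integral P (U i) + ennreal t * nn_integral Q (U i)" for i
      using seq by blast
    have sup: "nn_integral R (Sup (range U)) = (SUP i. nn_integral R (U i))"
      if "measurable R (borel :: ennreal measure) = measurable P borel" for R
    proof -
      have "nn_integral R (Sup (range U)) = (\<integral>\<^sup>+x. (SUP i. U i x) \<partial>R)"
        by (rule nn_integral_cong) (simp add: image_comp)
      also have "\<dots> = (SUP i. nn_integral R (U i))"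
        using seq that by (intro nn_integral_monotone_convergence_SUP) auto
      finally show ?thesis .
    qed
    have inc: "incseq (\<lambda>i. c * nn_integral R (U i))" for c R
      using incU by (intro monoI mult_left_mono nn_integral_mono) (auto simp: incseq_def le_fun_def)
    have "nn_integral (mixture t P Q) (Sup (range U))
        = (SUP i. ennreal (1 - t) * nn_integral P (U i) + ennreal t * nn_integral Q (U i))"
      unfolding sup[OF meas(1)] IH ..
    also have "\<dots> = (SUP i. ennreal (1 - t) * nn_integral P (U i)) + (SUP i. ennreal t * nn_integral Q (U i))"
      by (rule ennreal_SUP_add[OF inc inc])
    also have "\<dots> = ennreal (1 - t) * nn_integral P (Sup (range U)) + ennreal t * nn_integral Q (Sup (range U))"
      by (simp only: SUP_mult_left_ennreal[symmetric] sup meas(2) refl)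
    finally show ?case .
  qed
qed

lemma integrable_mixture:
  fixes f :: "'a \<Rightarrow> 'b::{banach, second_countable_topology}"
  assumes P: "prob_space P" and Q: "prob_space Q" and sets: "sets Q = sets P" and t: "0 \<le> t" "t \<le> 1"
    and f: "integrable P f" "integrable Q f"
  shows "integrable (mixture t P Q) f"
proof -
  have "f \<in> borel_measurable (mixture t P Q)"
    unfolding measurable_cong_sets[OF sets_mixture[OF P Q sets t] refl]
    using f(1) by (rule borel_measurable_integrable)
  moreover have "(\<integral>\<^sup>+x. norm (f x) \<partial>mixture t P Q) < \<infinity>"
  proof -
    have [measurable]: "f \<in> borel_measurable P" using f(1) by (rule borel_measurable_integrable)
    have "(\<integral>\<^sup>+x. norm (f x) \<partial>mixture t P Q)
        = ennreal (1 - t) * (\<integral>\<^sup>+x. norm (f x) \<partial>P) + ennreal t * (\<integral>\<^sup>+x. norm (f x) \<partial>Q)"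
      by (rule nn_integral_mixture[OF P Q sets t]) measurable
    then show ?thesis
      using f unfolding integrable_iff_bounded by (simp add: ennreal_mult_less_top)
  qed
  ultimately show ?thesis unfolding integrable_iff_bounded by blast
qed

lemma integral_mixture:
  fixes f :: "'a \<Rightarrow> real"
  assumes P: "prob_space P" and Q: "prob_space Q" and sets: "sets Q = sets P" and t: "0 \<le> t" "t \<le> 1"
    and f: "integrable P f" "integrable Q f"
  shows "(\<integral>z. f z \<partial>mixture t P Q) = (1 - t) * (\<integral>z. f z \<partial>P) + t * (\<integral>z. f z \<partial>Q)"
proof -
  have nn: "(\<integral>z. g z \<partial>mixture t P Q) = (1 - t) * (\<integral>z. g z \<partial>P) + t * (\<integral>z. g z \<partial>Q)"
    if g: "integrable P g" "integrable Q g" "\<And>z. 0 \<le> g z" for g :: "'a \<Rightarrow> real"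
  proof -
    have "ennreal (\<integral>z. g z \<partial>mixture t P Q) = (\<integral>\<^sup>+z. g z \<partial>mixture t P Q)"
      using g by (intro nn_integral_eq_integral[symmetric] integrable_mixture[OF P Q sets t]) auto
    also have "\<dots> = ennreal (1 - t) * ennreal (\<integral>z. g z \<partial>P) + ennreal t * ennreal (\<integral>z. g z \<partial>Q)"
      using g by (simp add: nn_integral_mixture[OF P Q sets t] nn_integral_eq_integral)
    also have "\<dots> = ennreal ((1 - t) * (\<integral>z. g z \<partial>P) + t * (\<integral>z. g z \<partial>Q))"
      using g t by (simp add: ennreal_mult ennreal_plus integral_nonneg_AE)
    finally show ?thesis using g t by (subst (asm) ennreal_inj) (auto intro!: integral_nonneg_AE add_nonneg_nonneg mult_nonneg_nonneg)
  qed
  have pm: "f = (\<lambda>z. max 0 (f z) - max 0 (- f z))" by auto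
  have i: "integrable R (\<lambda>z. max 0 (f z))" "integrable R (\<lambda>z. max 0 (- f z))" if "integrable R f" for R :: "'a measure"
    using that by auto
  have "(\<integral>z. max 0 (f z) - max 0 (- f z) \<partial>mixture t P Q)
     = (1 - t) * (\<integral>z. max 0 (f z) - max 0 (- f z) \<partial>P) + t * (\<integral>z. max 0 (f z) - max 0 (- f z) \<partial>Q)"
    using i[OF f(1)] i[OF f(2)]
    by (simp add: Bochner_Integration.integral_diff integrable_mixture[OF P Q sets t] nn algebra_simps)
  then show ?thesis by (simp flip: pm)
qed

lemma integrable_return_measure:
  fixes f :: "'a \<Rightarrow> 'b::{banach, second_countable_topology}"
  assumes x: "x \<in> space M" and f[measurable]: "f \<in> borel_measurable M"
  shows "integrable (return M x) f"
  unfolding integrable_iff_bounded using x by (simp add: nn_integral_return)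

lemma empirical_measure_properties:
  fixes f :: "'a \<Rightarrow> 'b::{banach, second_countable_topology}"
  assumes n: "n > 0" and z: "\<And>i. i < n \<Longrightarrow> z i \<in> space N"
  shows prob_space_empirical: "prob_space (empirical_measure N z n)"
    and sets_empirical: "sets (empirical_measure N z n) = sets N"
    and integrable_empirical: "f \<in> borel_measurable N \<Longrightarrow> integrable (empirical_measure N z n) f"
    and integral_empirical: "g \<in> borel_measurable N \<Longrightarrow>
       (\<integral>x. g x \<partial>empirical_measure N z n) = (\<Sum>i<n. g (z i) :: real) / real n"
proof -
  have z': "z \<in> measurable (uniform_count_measure {..<n}) N"
    using z by (auto simp: measurable_def space_uniform_count_measure sets_uniform_count_measure)
  interpret U: prob_space "uniform_count_measure {..<n}"
    using n by (intro prob_space_uniform_count_measure) auto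
  show "prob_space (empirical_measure N z n)" unfolding empirical_measure_def by (rule U.prob_space_distr[OF z'])
  show "sets (empirical_measure N z n) = sets N" by (simp add: empirical_measure_def)
  show "integrable (empirical_measure N z n) f" if "f \<in> borel_measurable N"
    unfolding empirical_measure_def integrable_distr_eq[OF z' that]
    unfolding uniform_count_measure_def by (rule integrable_point_measure_finite) simp
  show "(\<integral>x. g x \<partial>empirical_measure N z n) = (\<Sum>i<n. g (z i)) / real n" if "g \<in> borel_measurable N" for g :: "'a \<Rightarrow> real"
    unfolding empirical_measure_def integral_distr[OF z' that] by (simp add: integral_uniform_count_measure)
qed

lemma convex_on_finite_sum:
  assumes "finite I" "convex S" "\<And>i. i \<in> I \<Longrightarrow> convex_on S (f i)"
  shows "convex_on S (\<lambda>x. \<Sum>i\<in>I. f i x)"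
  using assms
proof (induction I rule: finite_induct)
  case (insert i I)
  then show ?case by (simp add: convex_on_add)
qed (simp add: convex_on_def)

lemma convex_on_integral:
  fixes L :: "'a \<Rightarrow> 'b::real_vector \<Rightarrow> real"
  assumes \<Theta>: "convex \<Theta>" and L: "\<And>z. z \<in> space F \<Longrightarrow> convex_on \<Theta> (L z)"
    and int: "\<And>\<theta>. \<theta> \<in> \<Theta> \<Longrightarrow> integrable F (\<lambda>z. L z \<theta>)"
  shows "convex_on \<Theta> (\<lambda>\<theta>. \<integral>z. L z \<theta> \<partial>F)"
proof (rule convex_onI)
  fix t :: real and x y assume t: "0 < t" "t < 1" and xy: "x \<in> \<Theta>" "y \<in> \<Theta>"
  have "(1 - t) *\<^sub>R x + t *\<^sub>R y \<in> \<Theta>" using \<Theta> xy t by (simp add: convex_alt)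
  then have "(\<integral>z. L z ((1 - t) *\<^sub>R x + t *\<^sub>R y) \<partial>F) \<le> (\<integral>z. (1 - t) * L z x + t * L z y \<partial>F)"
    using int xy t by (intro integral_mono) (auto intro!: convex_onD[OF L])
  then show "(\<integral>z. L z ((1 - t) *\<^sub>R x + t *\<^sub>R y) \<partial>F) \<le> (1 - t) * (\<integral>z. L z x \<partial>F) + t * (\<integral>z. L z y \<partial>F)"
    using int xy by simp
qed (fact \<Theta>)

lemma L2_fun_integrable:
  assumes F: "prob_space F" and f: "L2_fun F f"
  shows "integrable F f"
proof -
  interpret prob_space F by (rule F)
  have m[measurable]: "f \<in> borel_measurable F" using f by (simp add: L2_fun_def)
  have "integrable F (\<lambda>z. norm (f z))"
    by (rule square_integrable_imp_integrable) (use f in \<open>auto simp: L2_fun_def\<close>)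
  then show ?thesis using m by (simp add: integrable_norm_iff)
qed

lemma L2_fun_translate:
  assumes F: "prob_space F" and f: "L2_fun F (\<lambda>z. f z + a)"
  shows "L2_fun F f"
proof -
  interpret prob_space F by (rule F)
  have [measurable]: "(\<lambda>z. f z + a) \<in> borel_measurable F" using f by (simp add: L2_fun_def)
  have "(\<lambda>z. (f z + a) - a) \<in> borel_measurable F" by measurable
  then have m[measurable]: "f \<in> borel_measurable F" by simp
  have "integrable F (\<lambda>z. (norm (f z))\<^sup>2)"
  proof (rule Bochner_Integration.integrable_bound)
    show "integrable F (\<lambda>z. 2 * ((norm (f z + a))\<^sup>2 + (norm a)\<^sup>2))"
      using f by (simp add: L2_fun_def)
    show "AE z in F. norm ((norm (f z))\<^sup>2) \<le> norm (2 * ((norm (f z + a))\<^sup>2 + (norm a)\<^sup>2))"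
    proof (rule AE_I2)
      fix z
      have "norm (f z) \<le> norm (f z + a) + norm a" using norm_triangle_ineq4[of "f z + a" a] by simp
      then have "(norm (f z))\<^sup>2 \<le> (norm (f z + a) + norm a)\<^sup>2" by (rule power_mono) simp
      then show "norm ((norm (f z))\<^sup>2) \<le> norm (2 * ((norm (f z + a))\<^sup>2 + (norm a)\<^sup>2))"
        using sum_squares_bound[of "norm (f z + a)" "norm a"] by (simp add: power2_sum)
    qed
  qed measurable
  with m show ?thesis by (simp add: L2_fun_def)
qed

lemma L2_square_integrable_bound:
  fixes f :: "'a \<Rightarrow> real" and g k :: "'a \<Rightarrow> real^'p::finite"
  assumes "f \<in> borel_measurable F" "L2_fun F g" "L2_fun F k"
    and le: "\<And>z. z \<in> space F \<Longrightarrow> \<bar>f z\<bar> \<le> C * (norm (g z) + norm (k z))"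
  shows "integrable F (\<lambda>z. (f z)\<^sup>2)"
proof (rule Bochner_Integration.integrable_bound)
  show "integrable F (\<lambda>z. C\<^sup>2 * (2 * ((norm (g z))\<^sup>2 + (norm (k z))\<^sup>2)))"
    using assms by (auto simp: L2_fun_def)
  show "AE z in F. norm ((f z)\<^sup>2) \<le> norm (C\<^sup>2 * (2 * ((norm (g z))\<^sup>2 + (norm (k z))\<^sup>2)))"
  proof (rule AE_I2)
    fix z assume "z \<in> space F"
    from le[OF this] have "\<bar>f z\<bar>\<^sup>2 \<le> (C * (norm (g z) + norm (k z)))\<^sup>2" by (rule power_mono) simp
    also have "\<dots> \<le> C\<^sup>2 * (2 * ((norm (g z))\<^sup>2 + (norm (k z))\<^sup>2))"
      unfolding power_mult_distrib
      using sum_squares_bound[of "norm (g z)" "norm (k z)"] by (intro mult_left_mono) (auto simp: power2_sum)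
    finally show "norm ((f z)\<^sup>2) \<le> norm (C\<^sup>2 * (2 * ((norm (g z))\<^sup>2 + (norm (k z))\<^sup>2)))" by simp
  qed
qed (use assms in measurable)

section \<open>Convex M-estimation with a nondegenerate population minimizer\<close>

text \<open>
  The penalty enters only as a convex function and through the second-order expansion of the risk at
  $\theta_0$; stationarity of the risk is implicit in this expansion, which has no linear term. The
  operator \<open>Hi\<close> is the inverse of the Hessian \<open>H\<close>.
\<close>

locale convex_M_estimation =
  fixes F :: "'a measure" and \<Theta> :: "(real^'p::finite) set" and L :: "'a \<Rightarrow> real^'p \<Rightarrow> real"
    and \<phi> :: "'a \<Rightarrow> real^'p \<Rightarrow> real^'p" and J :: "real^'p \<Rightarrow> real" and \<theta>\<^sub>0 :: "real^'p"
    and H Hi :: "real^'p \<Rightarrow> real^'p" and c :: real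
  assumes prob_F: "prob_space F" and theta0: "\<theta>\<^sub>0 \<in> interior \<Theta>"
    and L_convex: "\<And>z. z \<in> space F \<Longrightarrow> convex_on \<Theta> (L z)"
    and L_deriv: "\<And>z \<theta>. z \<in> space F \<Longrightarrow> \<theta> \<in> interior \<Theta> \<Longrightarrow> (L z has_derivative (\<lambda>h. \<phi> z \<theta> \<bullet> h)) (at \<theta>)"
    and L_int: "\<And>\<theta>. \<theta> \<in> \<Theta> \<Longrightarrow> integrable F (\<lambda>z. L z \<theta>)"
    and \<phi>_L2: "\<And>\<theta>. \<theta> \<in> interior \<Theta> \<Longrightarrow> L2_fun F (\<lambda>z. \<phi> z \<theta>)"
    and J_convex: "convex_on \<Theta> J"
    and loss_deriv: "((\<lambda>\<theta>. \<integral>z. L z \<theta> \<partial>F) has_derivative (\<lambda>h. (\<integral>z. \<phi> z \<theta>\<^sub>0 \<partial>F) \<bullet> h)) (at \<theta>\<^sub>0)"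
    and risk_expansion: "\<And>u. ((\<lambda>s. (regularized_risk L J F (\<theta>\<^sub>0 + s *\<^sub>R u) - regularized_risk L J F \<theta>\<^sub>0) / s\<^sup>2)
            \<longlongrightarrow> (u \<bullet> H u) / 2) (at_right 0)"
    and H_lin: "linear H" and H_sym: "\<And>x y. H x \<bullet> y = x \<bullet> H y"
    and H_pos: "c > 0" "\<And>x. c * (norm x)\<^sup>2 \<le> x \<bullet> H x"
    and Hi: "linear Hi" "\<And>x. H (Hi x) = x"
begin

sublocale F: prob_space F by (rule prob_F)

definition mean_gradient :: "real^'p" where "mean_gradient = (\<integral>z. \<phi> z \<theta>\<^sub>0 \<partial>F)"

text \<open>
  The influence curve. It is written with the centred gradient of the loss, so that the penalty does
  not occur in it; under the Z-equation the centring constant is minus the gradient of the penalty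
  at $\theta_0$.
\<close>

definition \<psi> :: "'a \<Rightarrow> real^'p" where "\<psi> z = - Hi (\<phi> z \<theta>\<^sub>0 - mean_gradient)"

definition remainder :: "real \<Rightarrow> real^'p \<Rightarrow> 'a \<Rightarrow> real" where
  "remainder s u z = L z (\<theta>\<^sub>0 + s *\<^sub>R u) - L z \<theta>\<^sub>0 - s * (\<phi> z \<theta>\<^sub>0 \<bullet> u)"

lemma theta0_in: "\<theta>\<^sub>0 \<in> \<Theta>" using theta0 interior_subset by blast

lemma eventually_near: "\<forall>\<^sub>F s in at_right 0. \<theta>\<^sub>0 + s *\<^sub>R u \<in> interior \<Theta>"
proof -
  have "((\<lambda>s::real. \<theta>\<^sub>0 + s *\<^sub>R u) \<longlongrightarrow> \<theta>\<^sub>0 + 0 *\<^sub>R u) (at_right 0)" by (intro tendsto_intros)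
  then show ?thesis using topological_tendstoD[OF _ open_interior] theta0 by fastforce
qed

lemma H_\<psi>: "H (\<psi> z) = mean_gradient - \<phi> z \<theta>\<^sub>0"
  by (simp add: \<psi>_def linear_neg[OF H_lin] Hi)

lemma \<phi>_meas[measurable]: "\<theta> \<in> interior \<Theta> \<Longrightarrow> (\<lambda>z. \<phi> z \<theta>) \<in> borel_measurable F"
  using \<phi>_L2 by (simp add: L2_fun_def)

lemma L_meas[measurable]: "\<theta> \<in> \<Theta> \<Longrightarrow> (\<lambda>z. L z \<theta>) \<in> borel_measurable F"
  using L_int by auto

lemma \<phi>_int: "\<theta> \<in> interior \<Theta> \<Longrightarrow> integrable F (\<lambda>z. \<phi> z \<theta>)"
  by (rule L2_fun_integrable[OF prob_F \<phi>_L2])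

lemma expected_loss_convex: "convex_on \<Theta> (\<lambda>\<theta>. \<integral>z. L z \<theta> \<partial>F)"
  by (intro convex_on_integral convex_on_imp_convex[OF J_convex] L_convex L_int)

lemma \<psi>_meas[measurable]: "\<psi> \<in> borel_measurable F"
proof -
  have [measurable]: "Hi \<in> borel_measurable borel"
    using Hi(1) by (intro borel_measurable_continuous_onI linear_continuous_on) (simp add: linear_conv_bounded_linear)
  show ?thesis unfolding \<psi>_def using theta0 by measurable
qed

lemma \<psi>_mean: "(\<integral>z. \<psi> z $ j \<partial>F) = 0"
proof -
  have bl: "bounded_linear (\<lambda>x. - (Hi x $ j))"
    using Hi(1) bounded_linear_compose[OF bounded_linear_vec_nth, of Hi j]
    by (intro bounded_linear_minus) (simp add: linear_conv_bounded_linear)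
  have "(\<integral>z. \<psi> z $ j \<partial>F) = - (Hi (\<integral>z. \<phi> z \<theta>\<^sub>0 - mean_gradient \<partial>F) $ j)"
    unfolding \<psi>_def using integral_bounded_linear[OF bl, of F "\<lambda>z. \<phi> z \<theta>\<^sub>0 - mean_gradient"] \<phi>_int[OF theta0]
    by simp
  also have "(\<integral>z. \<phi> z \<theta>\<^sub>0 - mean_gradient \<partial>F) = 0"
    using \<phi>_int[OF theta0] by (simp add: mean_gradient_def F.prob_space)
  finally show ?thesis using linear_0[OF Hi(1)] by simp
qed

lemma \<psi>_square_int: "integrable F (\<lambda>z. (\<psi> z $ j)\<^sup>2)"
proof -
  have [measurable]: "(\<lambda>x :: real^'p. x $ j) \<in> borel_measurable borel"
    by (intro borel_measurable_continuous_onI continuous_intros)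
  obtain B where B: "B > 0" "\<And>x. norm (Hi x) \<le> norm x * B"
    using bounded_linear.pos_bounded Hi(1) linear_conv_bounded_linear by blast
  show ?thesis
  proof (rule L2_square_integrable_bound)
    show "L2_fun F (\<lambda>z. \<phi> z \<theta>\<^sub>0)" by (rule \<phi>_L2[OF theta0])
    show "L2_fun F (\<lambda>z. mean_gradient)" by (simp add: L2_fun_def)
    show "\<bar>\<psi> z $ j\<bar> \<le> B * (norm (\<phi> z \<theta>\<^sub>0) + norm mean_gradient)" for z
    proof -
      have "\<bar>\<psi> z $ j\<bar> \<le> norm (Hi (\<phi> z \<theta>\<^sub>0 - mean_gradient))"
        using component_le_norm_cart[of "\<psi> z" j] by (simp add: \<psi>_def)
      also have "\<dots> \<le> norm (\<phi> z \<theta>\<^sub>0 - mean_gradient) * B" by (rule B)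
      also have "\<dots> \<le> (norm (\<phi> z \<theta>\<^sub>0) + norm mean_gradient) * B"
        using B by (intro mult_right_mono norm_triangle_ineq4) auto
      finally show ?thesis by (simp add: mult.commute)
    qed
  qed measurable
qed

lemma remainder_meas: "\<theta>\<^sub>0 + s *\<^sub>R u \<in> \<Theta> \<Longrightarrow> remainder s u \<in> borel_measurable F"
  unfolding remainder_def using theta0 theta0_in by measurable

lemma remainder_nonneg: "z \<in> space F \<Longrightarrow> \<theta>\<^sub>0 + s *\<^sub>R u \<in> \<Theta> \<Longrightarrow> 0 \<le> remainder s u z"
  using convex_on_gradient_ineq[OF L_convex theta0 _ L_deriv[OF _ theta0]] by (fastforce simp: remainder_def)

text \<open>
  Convexity bounds the remainder by $s\,u \cdot (\varphi(z,\theta_0+su) - \varphi(z,\theta_0))$, and both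
  gradients are square integrable.
\<close>

lemma remainder_square_int: assumes s: "\<theta>\<^sub>0 + s *\<^sub>R u \<in> interior \<Theta>" shows "integrable F (\<lambda>z. (remainder s u z)\<^sup>2)"
proof (rule L2_square_integrable_bound[OF _ \<phi>_L2[OF s] \<phi>_L2[OF theta0]])
  have s': "\<theta>\<^sub>0 + s *\<^sub>R u \<in> \<Theta>" using s interior_subset by blast
  show "remainder s u \<in> borel_measurable F" by (rule remainder_meas[OF s'])
  show "\<bar>remainder s u z\<bar> \<le> (\<bar>s\<bar> * norm u) * (norm (\<phi> z (\<theta>\<^sub>0 + s *\<^sub>R u)) + norm (\<phi> z \<theta>\<^sub>0))" if z: "z \<in> space F" for z
  proof -
    have "L z (\<theta>\<^sub>0 + s *\<^sub>R u) - s * (\<phi> z (\<theta>\<^sub>0 + s *\<^sub>R u) \<bullet> u) \<le> L z \<theta>\<^sub>0"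
      using convex_on_gradient_ineq[OF L_convex[OF z] s theta0_in L_deriv[OF z s]] by simp
    then have "remainder s u z \<le> (\<phi> z (\<theta>\<^sub>0 + s *\<^sub>R u) - \<phi> z \<theta>\<^sub>0) \<bullet> (s *\<^sub>R u)"
      by (simp add: remainder_def inner_simps algebra_simps)
    also have "\<dots> \<le> norm (\<phi> z (\<theta>\<^sub>0 + s *\<^sub>R u) - \<phi> z \<theta>\<^sub>0) * norm (s *\<^sub>R u)" by (rule norm_cauchy_schwarz)
    also have "\<dots> \<le> (norm (\<phi> z (\<theta>\<^sub>0 + s *\<^sub>R u)) + norm (\<phi> z \<theta>\<^sub>0)) * norm (s *\<^sub>R u)"
      by (intro mult_right_mono norm_triangle_ineq4) auto
    finally show ?thesis using remainder_nonneg[OF z s'] by (simp add: mult.commute)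
  qed
qed

lemma remainder_int: "\<theta>\<^sub>0 + s *\<^sub>R u \<in> \<Theta> \<Longrightarrow> integrable F (remainder s u)"
  and remainder_mean: "\<theta>\<^sub>0 + s *\<^sub>R u \<in> \<Theta> \<Longrightarrow>
    (\<integral>z. remainder s u z \<partial>F) = (\<integral>z. L z (\<theta>\<^sub>0 + s *\<^sub>R u) \<partial>F) - (\<integral>z. L z \<theta>\<^sub>0 \<partial>F) - s * (mean_gradient \<bullet> u)"
  unfolding remainder_def mean_gradient_def using L_int theta0_in \<phi>_int[OF theta0] by simp_all

text \<open>
  By differentiability the quotient tends to \<open>0\<close> pointwise, and by convexity it decreases
  with \<open>s\<close>; its value at one fixed step \<open>b'\<close> therefore serves as dominating function.
\<close>

lemma remainder_L2_tendsto: "((\<lambda>s. \<integral>z. (remainder s u z / s)\<^sup>2 \<partial>F) \<longlongrightarrow> 0) (at_right 0)"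
proof -
  obtain b where b: "b > 0" "\<And>s. 0 < s \<Longrightarrow> s < b \<Longrightarrow> \<theta>\<^sub>0 + s *\<^sub>R u \<in> interior \<Theta>"
    using eventually_near[of u] unfolding eventually_at_right_field by auto
  define b' where "b' = b / 2"
  have b': "0 < b'" "b' < b" using b by (auto simp: b'_def)
  have inT: "\<theta>\<^sub>0 + s *\<^sub>R u \<in> \<Theta>" if "0 < s" "s \<le> b'" for s
    using b(2)[of s] that b' interior_subset by force
  show ?thesis
  proof (rule tendsto_at_right_sequentially[OF b'(1)])
    fix S :: "nat \<Rightarrow> real" assume S: "\<And>n. 0 < S n" "\<And>n. S n < b'" "S \<longlonglongrightarrow> 0"
    have "(\<lambda>n. \<integral>z. (remainder (S n) u z / S n)\<^sup>2 \<partial>F) \<longlonglongrightarrow> (\<integral>z. 0 \<partial>F)"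
    proof (rule integral_dominated_convergence)
      show "integrable F (\<lambda>z. (remainder b' u z / b')\<^sup>2)"
        using remainder_square_int[OF b(2)[OF b']] by (simp add: power_divide)
      show "(\<lambda>z. (remainder (S n) u z / S n)\<^sup>2) \<in> borel_measurable F" for n
        using remainder_meas[OF inT[OF S(1) less_imp_le[OF S(2)]]] by measurable
      show "AE z in F. norm ((remainder (S n) u z / S n)\<^sup>2) \<le> (remainder b' u z / b')\<^sup>2" for n
      proof (rule AE_I2)
        fix z assume z: "z \<in> space F"
        have "remainder (S n) u z / S n \<le> remainder b' u z / b'"
          unfolding remainder_def using S(1,2)[of n] b'
          by (intro convex_difference_quotient_mono[OF L_convex[OF z] theta0_in] inT) auto
        moreover have "0 \<le> remainder (S n) u z / S n"
          using remainder_nonneg[OF z inT] S(1,2)[of n] by (simp add: less_imp_le)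
        ultimately show "norm ((remainder (S n) u z / S n)\<^sup>2) \<le> (remainder b' u z / b')\<^sup>2"
          by (simp add: power_mono del: power_divide)
      qed
      show "AE z in F. (\<lambda>n. (remainder (S n) u z / S n)\<^sup>2) \<longlonglongrightarrow> 0"
      proof (rule AE_I2)
        fix z assume z: "z \<in> space F"
        have "((\<lambda>s. remainder s u z / s) \<longlongrightarrow> 0) (at_right 0)"
          unfolding remainder_def by (rule directional_remainder_tendsto[OF L_deriv[OF z theta0]])
        moreover have "filterlim S (at_right 0) sequentially"
          using S by (intro tendsto_imp_filterlim_at_right always_eventually) auto
        ultimately have "(\<lambda>n. remainder (S n) u z / S n) \<longlonglongrightarrow> 0" by (rule filterlim_compose)
        then show "(\<lambda>n. (remainder (S n) u z / S n)\<^sup>2) \<longlonglongrightarrow> 0" using tendsto_power[of _ 0 _ 2] by fastforce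
      qed
    qed measurable
    then show "(\<lambda>n. \<integral>z. (remainder (S n) u z / S n)\<^sup>2 \<partial>F) \<longlonglongrightarrow> 0" by simp
  qed
qed

text \<open>
  Applied to the unperturbed risk with \<open>v = 0\<close>, the localization puts every minimizer within
  distance \<open>s\<close> of $\theta_0$, for all small \<open>s\<close>.
\<close>

lemma population_minimizer:
  shows "\<exists>x. is_arg_min (regularized_risk L J F) (\<lambda>x. x \<in> \<Theta>) x"
    and "is_arg_min (regularized_risk L J F) (\<lambda>x. x \<in> \<Theta>) x \<Longrightarrow> x = \<theta>\<^sub>0"
proof -
  let ?f = "regularized_risk L J F"
  have cv: "convex_on \<Theta> ?f"
    unfolding regularized_risk_def[abs_def] by (intro convex_on_add expected_loss_convex J_convex)
  obtain K \<delta> s0 where K: "finite K" "\<delta> > 0" "s0 > 0"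
    "\<And>s f v. 0 < s \<Longrightarrow> s < s0 \<Longrightarrow> norm v \<le> 1 \<Longrightarrow> convex_on \<Theta> f \<Longrightarrow>
       (\<And>u. u \<in> K \<Longrightarrow> \<bar>(f (\<theta>\<^sub>0 + s *\<^sub>R u) - f \<theta>\<^sub>0) / s\<^sup>2 + H v \<bullet> u - (u \<bullet> H u) / 2\<bar> \<le> \<delta>) \<Longrightarrow>
       (\<exists>x. is_arg_min f (\<lambda>x. x \<in> \<Theta>) x) \<and>
       (\<forall>x. is_arg_min f (\<lambda>x. x \<in> \<Theta>) x \<longrightarrow> norm ((x - \<theta>\<^sub>0) /\<^sub>R s - v) < 1)"
    using perturbed_quadratic_minimizers[OF H_lin H_sym H_pos theta0 zero_less_one zero_less_one] by blast
  have "\<forall>\<^sub>F s in at_right 0. \<forall>u\<in>K. dist ((?f (\<theta>\<^sub>0 + s *\<^sub>R u) - ?f \<theta>\<^sub>0) / s\<^sup>2) ((u \<bullet> H u) / 2) < \<delta>"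
    by (intro eventually_ball_finite K(1) ballI tendstoD[OF risk_expansion] K(2))
  moreover have "\<forall>\<^sub>F s in at_right 0. 0 < s \<and> s < s0"
    using eventually_at_right_real[OF K(3)] by (auto elim: eventually_mono)
  ultimately have ev: "\<forall>\<^sub>F s in at_right 0. (\<exists>x. is_arg_min ?f (\<lambda>x. x \<in> \<Theta>) x) \<and>
       (\<forall>x. is_arg_min ?f (\<lambda>x. x \<in> \<Theta>) x \<longrightarrow> norm (x - \<theta>\<^sub>0) \<le> s)"
  proof eventually_elim
    case (elim s)
    have "(\<exists>x. is_arg_min ?f (\<lambda>x. x \<in> \<Theta>) x) \<and>
       (\<forall>x. is_arg_min ?f (\<lambda>x. x \<in> \<Theta>) x \<longrightarrow> norm ((x - \<theta>\<^sub>0) /\<^sub>R s - 0) < 1)"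
      using elim by (intro K(4) cv) (auto simp: dist_real_def linear_0[OF H_lin] less_imp_le)
    moreover have "norm (x - \<theta>\<^sub>0) \<le> s" if "norm ((x - \<theta>\<^sub>0) /\<^sub>R s - 0) < 1" for x
      using that elim by (simp add: divide_inverse[symmetric] less_imp_le flip: divide_inverse_commute)
    ultimately show ?case by blast
  qed
  from eventually_happens[OF ev] show "\<exists>x. is_arg_min ?f (\<lambda>x. x \<in> \<Theta>) x" by (auto simp: trivial_limit_at_right_real)
  show "x = \<theta>\<^sub>0" if x: "is_arg_min ?f (\<lambda>x. x \<in> \<Theta>) x"
  proof -
    have "norm (x - \<theta>\<^sub>0) \<le> 0"
    proof (rule tendsto_lowerbound[of "\<lambda>s. s" 0 "at_right (0::real)"])
      show "\<forall>\<^sub>F s in at_right 0. norm (x - \<theta>\<^sub>0) \<le> s" using ev by eventually_elim (use x in blast)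
    qed (auto intro!: tendsto_intros)
    then show ?thesis by simp
  qed
qed

text \<open>
  Here the mixing weight \<open>t\<close> is also the local scale. The perturbation of the risk is
  $t\,(L(z,\cdot) - E_F\,L)$, whose derivative at $\theta_0$ is $-t\,H\psi(z)$; divided by \<open>t\<^sup>2\<close>, its
  increment over $tu$ is the linear term $-H\psi(z) \cdot u$ up to an error that vanishes by
  differentiability.
\<close>

lemma contaminated_minimizers:
  assumes z: "z \<in> space F" and e: "e > 0"
  defines "f \<equiv> \<lambda>t \<theta>. (1 - t) * (\<integral>z. L z \<theta> \<partial>F) + t * L z \<theta> + J \<theta>"
  shows "\<forall>\<^sub>F t in at_right 0. (\<exists>x. is_arg_min (f t) (\<lambda>x. x \<in> \<Theta>) x) \<and>
       (\<forall>x. is_arg_min (f t) (\<lambda>x. x \<in> \<Theta>) x \<longrightarrow> norm ((x - \<theta>\<^sub>0) /\<^sub>R t - \<psi> z) < e)"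
proof -
  define R where "R = norm (\<psi> z) + 1"
  have R: "R > 0" by (simp add: R_def add_nonneg_pos)
  obtain K \<delta> s0 where K: "finite K" "\<delta> > 0" "s0 > 0"
    "\<And>s f v. 0 < s \<Longrightarrow> s < s0 \<Longrightarrow> norm v \<le> R \<Longrightarrow> convex_on \<Theta> f \<Longrightarrow>
       (\<And>u. u \<in> K \<Longrightarrow> \<bar>(f (\<theta>\<^sub>0 + s *\<^sub>R u) - f \<theta>\<^sub>0) / s\<^sup>2 + H v \<bullet> u - (u \<bullet> H u) / 2\<bar> \<le> \<delta>) \<Longrightarrow>
       (\<exists>x. is_arg_min f (\<lambda>x. x \<in> \<Theta>) x) \<and>
       (\<forall>x. is_arg_min f (\<lambda>x. x \<in> \<Theta>) x \<longrightarrow> norm ((x - \<theta>\<^sub>0) /\<^sub>R s - v) < e)"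
    using perturbed_quadratic_minimizers[OF H_lin H_sym H_pos theta0 R e] by blast
  define E where "E = (\<lambda>\<theta>. \<integral>z. L z \<theta> \<partial>F)"
  let ?q = "\<lambda>u t. (f t (\<theta>\<^sub>0 + t *\<^sub>R u) - f t \<theta>\<^sub>0) / t\<^sup>2 + H (\<psi> z) \<bullet> u"
  have lim: "(?q u \<longlongrightarrow> (u \<bullet> H u) / 2) (at_right 0)" for u
  proof -
    have "((\<lambda>t. (regularized_risk L J F (\<theta>\<^sub>0 + t *\<^sub>R u) - regularized_risk L J F \<theta>\<^sub>0) / t\<^sup>2
        + (L z (\<theta>\<^sub>0 + t *\<^sub>R u) - L z \<theta>\<^sub>0 - t * (\<phi> z \<theta>\<^sub>0 \<bullet> u)) / t
        - (E (\<theta>\<^sub>0 + t *\<^sub>R u) - E \<theta>\<^sub>0 - t * (mean_gradient \<bullet> u)) / t) \<longlongrightarrow> (u \<bullet> H u) / 2 + 0 - 0) (at_right 0)"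
      using loss_deriv unfolding E_def mean_gradient_def
      by (intro tendsto_intros risk_expansion directional_remainder_tendsto L_deriv z theta0)
    moreover have "\<forall>\<^sub>F t in at_right 0. (regularized_risk L J F (\<theta>\<^sub>0 + t *\<^sub>R u) - regularized_risk L J F \<theta>\<^sub>0) / t\<^sup>2
        + (L z (\<theta>\<^sub>0 + t *\<^sub>R u) - L z \<theta>\<^sub>0 - t * (\<phi> z \<theta>\<^sub>0 \<bullet> u)) / t
        - (E (\<theta>\<^sub>0 + t *\<^sub>R u) - E \<theta>\<^sub>0 - t * (mean_gradient \<bullet> u)) / t = ?q u t"
      using eventually_at_right_less[of "0::real"]
    proof eventually_elim
      case (elim t)
      then show ?case
        unfolding f_def regularized_risk_def H_\<psi> E_def[symmetric] fun_cong[OF E_def[symmetric]]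
        by (simp add: inner_simps field_simps power2_eq_square)
    qed
    ultimately show ?thesis by (auto intro: Lim_transform_eventually)
  qed
  have "\<forall>\<^sub>F t in at_right 0. \<forall>u\<in>K. dist (?q u t) ((u \<bullet> H u) / 2) < \<delta>"
    by (intro eventually_ball_finite K(1) ballI tendstoD[OF lim] K(2))
  moreover have "\<forall>\<^sub>F t in at_right 0. 0 < t \<and> t < s0"
    using eventually_at_right_real[OF K(3)] by (auto elim: eventually_mono)
  moreover have "\<forall>\<^sub>F t in at_right 0. 0 < t \<and> t < (1::real)"
    using eventually_at_right_real[OF zero_less_one] by (auto elim: eventually_mono)
  ultimately show ?thesis
  proof eventually_elim
    case (elim t)
    have "convex_on \<Theta> (f t)"
      unfolding f_def using elim
      by (intro convex_on_add convex_on_cmul expected_loss_convex L_convex J_convex z) auto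
    then show ?case
      using elim by (intro K(4)) (auto simp: R_def dist_real_def less_imp_le)
  qed
qed

text \<open>
  On the local scale $s = n^{-1/2}$ the increment of the empirical risk, divided by \<open>s\<^sup>2\<close>, is the sum of the linear term
  $-Hv_n \cdot u$ with $v_n = n^{-1/2}\sum_i \psi(Z_i)$, the population risk's increment divided by \<open>s\<^sup>2\<close>, and the
  sum over the sample of the centred remainders. The last term is small in probability, since its
  variance is at most $n$ times the second moment of one remainder. The exceptional event \<open>A\<close> collects
  the finitely many events where this fails for some test point \<open>u\<close> in \<open>K\<close> or where $v_n$ leaves the
  ball of radius \<open>R\<close>.
\<close>

lemma empirical_minimizers:
  fixes M :: "'w measure" and Z :: "nat \<Rightarrow> 'w \<Rightarrow> 'a"
  assumes M: "prob_space M" and indep: "prob_space.indep_vars M (\<lambda>i. N) Z UNIV"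
    and distr: "\<And>i. distr M N (Z i) = F" and e: "e > 0" and r: "r > 0"
  defines "f \<equiv> \<lambda>n \<omega> \<theta>. (\<Sum>i<n. L (Z i \<omega>) \<theta>) / real n + J \<theta>"
  shows "\<forall>\<^sub>F n in sequentially. \<exists>A\<in>sets M. measure M A < r \<and> (\<forall>\<omega>\<in>space M - A.
      (\<exists>x. is_arg_min (f n \<omega>) (\<lambda>x. x \<in> \<Theta>) x) \<and>
      (\<forall>x. is_arg_min (f n \<omega>) (\<lambda>x. x \<in> \<Theta>) x \<longrightarrow>
         norm (sqrt n *\<^sub>R (x - \<theta>\<^sub>0) - (\<Sum>i<n. \<psi> (Z i \<omega>)) /\<^sub>R sqrt n) < e))"
proof -
  interpret M: prob_space M by (rule M)
  have sN: "sets F = sets N" using distr[of 0] by (metis sets_distr)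
  have spN: "space F = space N" using sN by (rule sets_eq_imp_space_eq)
  have mN: "measurable N (borel :: real measure) = measurable F borel"
    "measurable N (borel :: (real^'p) measure) = measurable F borel"
    using sN by (auto intro!: measurable_cong_sets)
  have Zm: "Z i \<in> measurable M N" for i using indep by (simp add: M.indep_vars_def2)
  have Zsp: "Z i \<omega> \<in> space F" if "\<omega> \<in> space M" for i \<omega>
    using measurable_space[OF Zm that] spN by simp
  have vec_nth_meas: "(\<lambda>x :: real^'p. x $ j) \<in> borel_measurable borel" for j
    by (intro borel_measurable_continuous_onI continuous_intros)
  have \<psi>j: "(\<lambda>z. \<psi> z $ j) \<in> borel_measurable N" for j
    unfolding mN using measurable_compose[OF \<psi>_meas vec_nth_meas] .
  define v where "v = (\<lambda>n \<omega>. (\<Sum>i<n. \<psi> (Z i \<omega>)) /\<^sub>R sqrt (real n))"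
  \<comment> \<open>\<open>a\<close> is chosen so that Chebyshev's inequality bounds every coordinate of \<open>v n\<close> by \<open>a\<close> at once,
     and hence the norm of \<open>v n\<close> by \<open>R\<close>, outside an event of probability below \<open>r / 2\<close>\<close>
  define B where "B = (\<Sum>j\<in>UNIV. \<integral>z. (\<psi> z $ j)\<^sup>2 \<partial>F)"
  have B: "B \<ge> 0" unfolding B_def by (intro sum_nonneg integral_nonneg_AE) auto
  define a where "a = sqrt (2 * (B + 1) / r)"
  have a: "a > 0" "a\<^sup>2 = 2 * (B + 1) / r" using B r by (auto simp: a_def)
  define R where "R = real CARD('p) * a"
  have R: "R > 0" using a by (simp add: R_def)
  define A1 where "A1 = (\<lambda>n j. {\<omega>\<in>space M. a * sqrt n \<le> \<bar>\<Sum>i<n. \<psi> (Z i \<omega>) $ j\<bar>})"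
  have A1_sets: "A1 n j \<in> sets M" for n j
    unfolding A1_def using \<psi>j[of j] Zm by measurable
  have A1: "measure M (\<Union>j. A1 n j) < r / 2" if n: "n > 0" for n
  proof -
    have "measure M (\<Union>j. A1 n j) \<le> (\<Sum>j\<in>UNIV. measure M (A1 n j))"
      using A1_sets by (intro M.finite_measure_subadditive_finite) auto
    also have "\<dots> \<le> (\<Sum>j\<in>UNIV. (\<integral>z. (\<psi> z $ j)\<^sup>2 \<partial>F) / a\<^sup>2)"
    proof (rule sum_mono)
      fix j
      have "measure M (A1 n j) \<le> real n * (\<integral>z. (\<psi> z $ j)\<^sup>2 \<partial>F) / (a * sqrt n)\<^sup>2"
        unfolding A1_def using a n
        by (intro M.Chebyshev_sum_independent[OF indep distr \<psi>j \<psi>_square_int \<psi>_mean]) auto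
      then show "measure M (A1 n j) \<le> (\<integral>z. (\<psi> z $ j)\<^sup>2 \<partial>F) / a\<^sup>2"
        using n by (simp add: power_mult_distrib)
    qed
    also have "\<dots> = B / a\<^sup>2" by (simp add: B_def sum_divide_distrib)
    also have "\<dots> < r / 2" unfolding a(2) using B r by (simp add: field_simps)
    finally show ?thesis .
  qed
  have v_bound: "norm (v n \<omega>) \<le> R" if "\<omega> \<in> space M - (\<Union>j. A1 n j)" "n > 0" for n \<omega>
  proof -
    have "norm (v n \<omega>) \<le> (\<Sum>j\<in>UNIV. \<bar>v n \<omega> $ j\<bar>)" by (rule norm_le_l1_cart)
    also have "\<dots> \<le> (\<Sum>j\<in>(UNIV::'p set). a)"
    proof (rule sum_mono)
      fix j
      have "\<bar>\<Sum>i<n. \<psi> (Z i \<omega>) $ j\<bar> < a * sqrt n" using that by (auto simp: A1_def not_le)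
      then show "\<bar>v n \<omega> $ j\<bar> \<le> a" using that(2) by (simp add: v_def abs_mult field_simps)
    qed
    finally show ?thesis by (simp add: R_def)
  qed
  obtain K \<delta> s0 where K: "finite K" "\<delta> > 0" "s0 > 0"
    "\<And>s f v. 0 < s \<Longrightarrow> s < s0 \<Longrightarrow> norm v \<le> R \<Longrightarrow> convex_on \<Theta> f \<Longrightarrow>
       (\<And>u. u \<in> K \<Longrightarrow> \<bar>(f (\<theta>\<^sub>0 + s *\<^sub>R u) - f \<theta>\<^sub>0) / s\<^sup>2 + H v \<bullet> u - (u \<bullet> H u) / 2\<bar> \<le> \<delta>) \<Longrightarrow>
       (\<exists>x. is_arg_min f (\<lambda>x. x \<in> \<Theta>) x) \<and>
       (\<forall>x. is_arg_min f (\<lambda>x. x \<in> \<Theta>) x \<longrightarrow> norm ((x - \<theta>\<^sub>0) /\<^sub>R s - v) < e)"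
    using perturbed_quadratic_minimizers[OF H_lin H_sym H_pos theta0 R e] by blast
  define s where "s = (\<lambda>n. 1 / sqrt (real n))"
  have s_lim: "filterlim s (at_right 0) sequentially"
  proof (rule tendsto_imp_filterlim_at_right)
    show "s \<longlonglongrightarrow> 0" unfolding s_def by real_asymp
    show "\<forall>\<^sub>F n in sequentially. s n > 0"
      unfolding s_def using eventually_gt_at_top[of 0] by eventually_elim simp
  qed
  define V where "V = (\<lambda>s u z. remainder s u z - (\<integral>z. remainder s u z \<partial>F))"
  define A2 where "A2 = (\<lambda>n u. {\<omega>\<in>space M. \<delta> / 2 \<le> \<bar>\<Sum>i<n. V (s n) u (Z i \<omega>)\<bar>})"
  \<comment> \<open>the share of each test point in the remaining probability \<open>r / 2\<close>\<close>
  define rho where "rho = r / (2 * (real (card K) + 1))"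
  have rho: "rho > 0" using r by (simp add: rho_def add_nonneg_pos)
  let ?Phi = "regularized_risk L J F"
  have "\<forall>\<^sub>F n in sequentially. \<forall>u\<in>K. \<theta>\<^sub>0 + s n *\<^sub>R u \<in> interior \<Theta>"
    by (intro eventually_ball_finite K(1) ballI eventually_compose_filterlim[OF eventually_near s_lim])
  moreover have "\<forall>\<^sub>F n in sequentially. \<forall>u\<in>K. dist (\<integral>z. (remainder (s n) u z / s n)\<^sup>2 \<partial>F) 0 < rho * (\<delta> / 2)\<^sup>2"
    using rho K(2)
    by (intro eventually_ball_finite K(1) ballI tendstoD[OF filterlim_compose[OF remainder_L2_tendsto s_lim]]) auto
  moreover have "\<forall>\<^sub>F n in sequentially. \<forall>u\<in>K.
      dist ((?Phi (\<theta>\<^sub>0 + s n *\<^sub>R u) - ?Phi \<theta>\<^sub>0) / (s n)\<^sup>2) ((u \<bullet> H u) / 2) < \<delta> / 2"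
    using K(2)
    by (intro eventually_ball_finite K(1) ballI tendstoD[OF filterlim_compose[OF risk_expansion s_lim]]) auto
  moreover have "\<forall>\<^sub>F n in sequentially. 0 < s n \<and> s n < s0"
    using eventually_compose_filterlim[OF eventually_at_right_real[OF K(3)] s_lim] by simp
  moreover have "\<forall>\<^sub>F n in sequentially. n > (0::nat)" by (rule eventually_gt_at_top)
  ultimately show ?thesis
  proof eventually_elim
    case (elim n)
    have n: "n > 0" and s: "0 < s n" "s n < s0" using elim by auto
    have ns: "real n = 1 / (s n)\<^sup>2" "sqrt n = 1 / s n" using n by (auto simp: s_def power_divide)
    have inT: "\<theta>\<^sub>0 + s n *\<^sub>R u \<in> interior \<Theta>" "\<theta>\<^sub>0 + s n *\<^sub>R u \<in> \<Theta>" if "u \<in> K" for u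
      using elim(1) that interior_subset by blast+
    have V_meas: "V (s n) u \<in> borel_measurable N" if "u \<in> K" for u
      unfolding mN V_def using remainder_meas[OF inT(2)[OF that]] by measurable
    have A2_sets: "A2 n u \<in> sets M" if "u \<in> K" for u
      unfolding A2_def using V_meas[OF that] Zm by measurable
    have A2: "measure M (A2 n u) \<le> rho" if u: "u \<in> K" for u
    proof -
      have Wi: "integrable F (remainder (s n) u)" "integrable F (\<lambda>z. (remainder (s n) u z)\<^sup>2)"
        using remainder_int remainder_square_int inT u by auto
      have Vi: "integrable F (\<lambda>z. (V (s n) u z)\<^sup>2)"
        unfolding V_def power2_diff using Wi by simp
      have V0: "(\<integral>z. V (s n) u z \<partial>F) = 0"
        unfolding V_def using Wi by (simp add: F.prob_space)
      have "measure M (A2 n u) \<le> real n * (\<integral>z. (V (s n) u z)\<^sup>2 \<partial>F) / (\<delta> / 2)\<^sup>2"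
        unfolding A2_def using K(2)
        by (intro M.Chebyshev_sum_independent[OF indep distr V_meas[OF u] Vi V0]) simp
      also have "(\<integral>z. (V (s n) u z)\<^sup>2 \<partial>F) \<le> (\<integral>z. (remainder (s n) u z)\<^sup>2 \<partial>F)"
        unfolding V_def using F.variance_eq[OF Wi] by simp
      also have "real n * (\<integral>z. (remainder (s n) u z)\<^sup>2 \<partial>F) = (\<integral>z. (remainder (s n) u z / s n)\<^sup>2 \<partial>F)"
        unfolding ns(1) by (simp add: power_divide)
      also have "\<dots> \<le> rho * (\<delta> / 2)\<^sup>2" using elim(2) u by (force simp: dist_real_def)
      finally show ?thesis using K(2) by (simp add: divide_right_mono mult_left_mono)
    qed
    define A where "A = (\<Union>j. A1 n j) \<union> (\<Union>u\<in>K. A2 n u)"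
    have "A \<in> sets M" unfolding A_def using A1_sets A2_sets K(1) by (intro sets.Un sets.finite_UN) auto
    moreover have "measure M A < r"
    proof -
      have "measure M A \<le> measure M (\<Union>j. A1 n j) + measure M (\<Union>u\<in>K. A2 n u)"
        unfolding A_def using A1_sets A2_sets K(1)
        by (intro measure_Un_le sets.finite_UN) auto
      also have "measure M (\<Union>u\<in>K. A2 n u) \<le> (\<Sum>u\<in>K. measure M (A2 n u))"
        using A2_sets K(1) by (intro M.finite_measure_subadditive_finite) auto
      also have "\<dots> \<le> (\<Sum>u\<in>K. rho)" using A2 by (rule sum_mono)
      also have "\<dots> = real (card K) * rho" by simp
      also have "\<dots> \<le> r / 2" using r by (simp add: rho_def field_simps)
      finally show ?thesis using A1[OF n] by simp
    qed
    moreover have "(\<exists>x. is_arg_min (f n \<omega>) (\<lambda>x. x \<in> \<Theta>) x) \<and>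
      (\<forall>x. is_arg_min (f n \<omega>) (\<lambda>x. x \<in> \<Theta>) x \<longrightarrow> norm ((x - \<theta>\<^sub>0) /\<^sub>R s n - v n \<omega>) < e)"
      if \<omega>: "\<omega> \<in> space M - A" for \<omega>
    proof (rule K(4)[OF s])
      show "norm (v n \<omega>) \<le> R" using v_bound[of \<omega> n] \<omega> n by (auto simp: A_def)
      show "convex_on \<Theta> (f n \<omega>)"
      proof -
        have "convex_on \<Theta> (\<lambda>\<theta>. \<Sum>i<n. L (Z i \<omega>) \<theta>)"
          using L_convex Zsp \<omega> by (intro convex_on_finite_sum convex_on_imp_convex[OF J_convex]) auto
        then have "convex_on \<Theta> (\<lambda>\<theta>. (1 / real n) * (\<Sum>i<n. L (Z i \<omega>) \<theta>) + J \<theta>)"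
          by (intro convex_on_add convex_on_cmul J_convex) auto
        then show ?thesis by (simp add: f_def)
      qed
      fix u assume u: "u \<in> K"
      have "\<bar>\<Sum>i<n. V (s n) u (Z i \<omega>)\<bar> < \<delta> / 2" using \<omega> u by (auto simp: A_def A2_def not_le)
      moreover have "\<bar>(?Phi (\<theta>\<^sub>0 + s n *\<^sub>R u) - ?Phi \<theta>\<^sub>0) / (s n)\<^sup>2 - (u \<bullet> H u) / 2\<bar> < \<delta> / 2"
        using elim(3) u by (auto simp: dist_real_def)
      moreover have "(f n \<omega> (\<theta>\<^sub>0 + s n *\<^sub>R u) - f n \<omega> \<theta>\<^sub>0) / (s n)\<^sup>2 + H (v n \<omega>) \<bullet> u
          = (\<Sum>i<n. V (s n) u (Z i \<omega>)) + (?Phi (\<theta>\<^sub>0 + s n *\<^sub>R u) - ?Phi \<theta>\<^sub>0) / (s n)\<^sup>2"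
      proof -
        define m where "m = mean_gradient \<bullet> u"
        define P where "P = (\<Sum>i<n. \<phi> (Z i \<omega>) \<theta>\<^sub>0 \<bullet> u)"
        define D where "D = (\<Sum>i<n. L (Z i \<omega>) (\<theta>\<^sub>0 + s n *\<^sub>R u)) - (\<Sum>i<n. L (Z i \<omega>) \<theta>\<^sub>0)"
        define E where "E = (\<integral>z. L z (\<theta>\<^sub>0 + s n *\<^sub>R u) \<partial>F) - (\<integral>z. L z \<theta>\<^sub>0 \<partial>F)"
        define G where "G = J (\<theta>\<^sub>0 + s n *\<^sub>R u) - J \<theta>\<^sub>0"
        have Hv: "H (v n \<omega>) \<bullet> u = s n * (real n * m - P)"
        proof -
          have "H (v n \<omega>) = s n *\<^sub>R (\<Sum>i<n. H (\<psi> (Z i \<omega>)))"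
            by (simp add: v_def s_def linear_scale[OF H_lin] linear_sum[OF H_lin] divide_inverse)
          then show ?thesis
            by (simp add: H_\<psi> m_def P_def sum_subtractf inner_diff_left inner_sum_left sum_constant_scaleR
                del: sum_constant)
        qed
        have V: "(\<Sum>i<n. V (s n) u (Z i \<omega>)) = D - s n * P - real n * (E - s n * m)"
          unfolding V_def remainder_mean[OF inT(2)[OF u]]
          by (simp add: remainder_def D_def P_def E_def m_def sum_subtractf sum_distrib_left)
        have f: "f n \<omega> (\<theta>\<^sub>0 + s n *\<^sub>R u) - f n \<omega> \<theta>\<^sub>0 = D / real n + G"
          by (simp add: f_def D_def G_def diff_divide_distrib)
        have Phi: "?Phi (\<theta>\<^sub>0 + s n *\<^sub>R u) - ?Phi \<theta>\<^sub>0 = E + G"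
          by (simp add: regularized_risk_def E_def G_def)
        have div: "x / (s n)\<^sup>2 = real n * x" for x by (simp add: ns(1))
        show ?thesis unfolding f Phi Hv V div using n by (simp add: field_simps)
      qed
      ultimately show "\<bar>(f n \<omega> (\<theta>\<^sub>0 + s n *\<^sub>R u) - f n \<omega> \<theta>\<^sub>0) / (s n)\<^sup>2 + H (v n \<omega>) \<bullet> u - (u \<bullet> H u) / 2\<bar> \<le> \<delta>"
        by linarith
    qed
    moreover have "(x - \<theta>\<^sub>0) /\<^sub>R s n = sqrt n *\<^sub>R (x - \<theta>\<^sub>0)" for x
      unfolding ns(2) by (simp add: divide_inverse)
    ultimately show ?case unfolding v_def by auto
  qed
qed

end

section \<open>Asymptotic linearity of the regularized M-estimator\<close>

lemma is_arg_min_on_cong: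
  assumes "\<And>x. x \<in> S \<Longrightarrow> f x = g x"
  shows "is_arg_min f (\<lambda>x. x \<in> S) = is_arg_min g (\<lambda>x. x \<in> S)"
  using assms by (auto simp: is_arg_min_def fun_eq_iff)

theorem theorem3p4:
  fixes X :: "(real^'p::finite) set" and Y :: "real set" and N :: "((real^'p) \<times> real) measure"
    and \<Theta> :: "(real^'p) set" and P :: "real^'p \<Rightarrow> ((real^'p) \<times> real) measure"
    and F :: "((real^'p) \<times> real) measure" and \<theta>\<^sub>0 :: "real^'p"
    and \<Lambda> :: "real^'p \<Rightarrow> (real^'p) \<times> real \<Rightarrow> real^'p"
    and M :: "'w measure" and Z :: "nat \<Rightarrow> 'w \<Rightarrow> (real^'p) \<times> real"
    and L :: "(real^'p) \<times> real \<Rightarrow> real^'p \<Rightarrow> real" and \<phi> :: "(real^'p) \<times> real \<Rightarrow> real^'p \<Rightarrow> real^'p"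
    and J :: "real^'p \<Rightarrow> real" and J' :: "real^'p \<Rightarrow> real^'p"
    and Jm :: "nat \<Rightarrow> real^'p \<Rightarrow> real" and Jm' :: "nat \<Rightarrow> real^'p \<Rightarrow> real^'p"
    and \<phi>reg :: "(real^'p) \<times> real \<Rightarrow> real^'p \<Rightarrow> real^'p" and \<eta>reg :: "real^'p \<Rightarrow> real^'p"
    and d\<eta> :: "real^'p \<Rightarrow> real^'p"
    and \<D> :: "((real^'p) \<times> real) measure set"
    and Tm :: "nat \<Rightarrow> ((real^'p) \<times> real) measure \<Rightarrow> real^'p"
    and T :: "((real^'p) \<times> real) measure \<Rightarrow> real^'p"
    and S :: "nat \<Rightarrow> 'w \<Rightarrow> real^'p"
  assumes N: "N = sample_space X Y"
    and model: "linear_regression_model N \<Theta> P"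
    and F: "F = P \<theta>\<^sub>0"
    and M: "prob_space M"
    and Z_indep: "prob_space.indep_vars M (\<lambda>i. N) Z UNIV"
    and Z_distr: "\<And>i. distr M N (Z i) = F"
    and L_nonneg: "\<And>z \<theta>. z \<in> X \<times> Y \<Longrightarrow> \<theta> \<in> \<Theta> \<Longrightarrow> 0 \<le> L z \<theta>"
    and phi: "\<And>z. z \<in> X \<times> Y \<Longrightarrow> gradient_on \<Theta> (L z) (\<phi> z)"
    and L_integrable: "\<And>\<theta>. \<theta> \<in> \<Theta> \<Longrightarrow> integrable F (\<lambda>z. L z \<theta>)"
    and interchange: "gradient_on \<Theta> (\<lambda>\<theta>. \<integral>z. L z \<theta> \<partial>F) (\<lambda>\<theta>. \<integral>z. \<phi> z \<theta> \<partial>F)"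
    and J': "penalty_gradient \<Theta> J J'"
    and phi_reg: "\<phi>reg = (\<lambda>z \<theta>. \<phi> z \<theta> + J' \<theta>)"
    and eta_reg: "\<eta>reg = (\<lambda>\<theta>. (\<integral>z. \<phi> z \<theta> \<partial>F) + J' \<theta>)"
    and Jm_smooth: "\<And>m. smooth_on \<Theta> (Jm m)"
    and Jm': "\<And>m. gradient_on \<Theta> (Jm m) (Jm' m)"
    and Jm_tendsto: "tendsto_W22 \<Theta> Jm J"
    and D: "\<D> = functional_domain N \<Theta> L \<phi>"
    and Tm: "\<And>m. Z_functional \<D> \<Theta> \<phi> (Jm' m) (Tm m)"
    and T_lim: "\<And>G. G \<in> \<D> \<Longrightarrow> (\<lambda>m. Tm m G) \<longlonglongrightarrow> T G"
    and T: "M_functional \<D> \<Theta> L J T"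
    and S: "S = (\<lambda>n \<omega>. T (empirical_measure N (\<lambda>i. Z i \<omega>) n))"
    and S_measurable: "\<And>n. S n \<in> borel_measurable M"
    and L2_diff: "\<And>\<theta>. \<theta> \<in> interior \<Theta> \<Longrightarrow> L2_derivative P \<theta> (\<Lambda> \<theta>)"
    and IC: "\<And>\<theta> \<psi>. \<theta> \<in> interior \<Theta> \<Longrightarrow> influence_curve T (P \<theta>) \<psi> \<Longrightarrow> \<psi> \<in> Psi2 (P \<theta>) (\<Lambda> \<theta>)"
    and Theta: "\<Theta> \<noteq> {}" "compact \<Theta>" "closure (interior \<Theta>) = \<Theta>"
    and L2_phi: "\<And>\<theta>. \<theta> \<in> \<Theta> \<Longrightarrow> L2_fun F (\<lambda>z. \<phi>reg z \<theta>)"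
    and theta0: "\<theta>\<^sub>0 \<in> interior \<Theta>" "\<eta>reg \<theta>\<^sub>0 = 0"
    and eta_homeo: "locally_homeomorphic_at \<Theta> \<eta>reg \<theta>\<^sub>0"
    and eta_deriv: "(\<eta>reg has_derivative d\<eta>) (at \<theta>\<^sub>0)" "bounded_linear d\<eta>" "bij d\<eta>"
    and J_nonneg: "\<And>\<theta>. \<theta> \<in> \<Theta> \<Longrightarrow> 0 \<le> J \<theta>"
    and J_convex: "convex_on \<Theta> J"
    and J_0: "0 \<in> \<Theta>" "J 0 = 0"
    and S_consistent: "root_n_consistent M S \<theta>\<^sub>0"
    and L_convex: "\<And>z. z \<in> X \<times> Y \<Longrightarrow> convex_on \<Theta> (L z)"
    and L_C2: "\<And>z. z \<in> X \<times> Y \<Longrightarrow> Ck_on 2 \<Theta> (L z)"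
  shows "asymptotically_linear T F (\<Lambda> \<theta>\<^sub>0) \<theta>\<^sub>0 M Z S"
proof -
  have \<theta>\<Theta>: "\<theta>\<^sub>0 \<in> \<Theta>" using theta0(1) interior_subset by blast
  have F_prob: "prob_space F" and sF: "sets F = sets N"
    using model \<theta>\<Theta> by (auto simp: F linear_regression_model_def)
  interpret F: prob_space F by (rule F_prob)
  interpret M: prob_space M by (rule M)
  have spN: "space N = X \<times> Y" by (simp add: N sample_space_def space_restrict_space)
  have spF: "space F = X \<times> Y" using sets_eq_imp_space_eq[OF sF] spN by simp
  have \<phi>_L2: "L2_fun F (\<lambda>z. \<phi> z \<theta>)" if "\<theta> \<in> \<Theta>" for \<theta>
    using L2_fun_translate[OF F_prob, of "\<lambda>z. \<phi> z \<theta>" "J' \<theta>"] L2_phi[OF that] by (simp add: phi_reg)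
  have \<phi>_meas: "(\<lambda>z. \<phi> z \<theta>) \<in> borel_measurable N" if "\<theta> \<in> \<Theta>" for \<theta>
    using \<phi>_L2[OF that] measurable_cong_sets[OF sF refl] by (auto simp: L2_fun_def)
  have L_meas: "(\<lambda>z. L z \<theta>) \<in> borel_measurable N" if "\<theta> \<in> \<Theta>" for \<theta>
    using borel_measurable_integrable[OF L_integrable[OF that]] measurable_cong_sets[OF sF refl] by blast
  have \<phi>_int: "integrable F (\<lambda>z. \<phi> z \<theta>)" if "\<theta> \<in> \<Theta>" for \<theta>
    by (rule L2_fun_integrable[OF F_prob \<phi>_L2[OF that]])
  let ?E = "\<lambda>\<theta>. \<integral>z. L z \<theta> \<partial>F" and ?\<Phi> = "regularized_risk L J F"
  have L_deriv: "(L z has_derivative (\<lambda>h. \<phi> z \<theta> \<bullet> h)) (at \<theta>)" if "z \<in> space F" "\<theta> \<in> interior \<Theta>" for z \<theta>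
    using phi[of z] that interior_subset[of \<Theta>] at_within_interior[OF that(2)]
    unfolding gradient_on_def spF by (metis subsetD)
  have E_deriv: "(?E has_derivative (\<lambda>h. (\<integral>z. \<phi> z \<theta> \<partial>F) \<bullet> h)) (at \<theta>)" if "\<theta> \<in> interior \<Theta>" for \<theta>
    using interchange that interior_subset[of \<Theta>] at_within_interior[OF that]
    unfolding gradient_on_def by (metis subsetD)
  have \<Phi>_convex: "convex_on \<Theta> ?\<Phi>"
    unfolding regularized_risk_def[abs_def]
    using L_convex L_integrable J_convex spF
    by (intro convex_on_add convex_on_integral convex_on_imp_convex[OF J_convex]) auto

  \<comment> \<open>where the risk is differentiable, so is the penalty, because the expected loss is; hence \<open>J'\<close> is its
     classical gradient there, and the gradient of the risk is \<open>\<eta>reg\<close>\<close>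
  obtain U where U: "open U" "\<theta>\<^sub>0 \<in> U" "U \<subseteq> \<Theta>" and \<eta>_cont: "continuous_on U \<eta>reg"
    using eta_homeo unfolding locally_homeomorphic_at_def homeomorphism_def by blast
  have \<Phi>_deriv: "(?\<Phi> has_derivative (\<lambda>h. \<eta>reg x \<bullet> h)) (at x)" if "x \<in> U" for x
  proof (rule convex_gradient_extends[OF \<Phi>_convex U(1,3) \<eta>_cont _ that])
    fix y g assume y: "y \<in> U" and g: "(?\<Phi> has_derivative (\<lambda>h. g \<bullet> h)) (at y)"
    have yI: "y \<in> interior \<Theta>" using y U(1,3) interior_maximal by blast
    have "((\<lambda>\<theta>. ?\<Phi> \<theta> - ?E \<theta>) has_derivative (\<lambda>h. g \<bullet> h - (\<integral>z. \<phi> z y \<partial>F) \<bullet> h)) (at y)"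
      by (intro has_derivative_diff g E_deriv yI)
    then have "(J has_derivative (\<lambda>h. (g - (\<integral>z. \<phi> z y \<partial>F)) \<bullet> h)) (at y within \<Theta>)"
      unfolding at_within_interior[OF yI] by (simp add: regularized_risk_def[abs_def] inner_diff_left)
    then have "J' y = g - (\<integral>z. \<phi> z y \<partial>F)"
      using J' y U(3) unfolding penalty_gradient_def by blast
    then show "g = \<eta>reg y" by (simp add: eta_reg)
  qed

  have H_lin: "linear d\<eta>" using eta_deriv(2) by (simp add: linear_conv_bounded_linear)
  have H_sym: "d\<eta> u \<bullet> v = u \<bullet> d\<eta> v" for u v
    by (rule symmetric_of_gradient_derivative[OF U(1,2) \<Phi>_deriv eta_deriv(1)])
  have expansion: "((\<lambda>s. (?\<Phi> (\<theta>\<^sub>0 + s *\<^sub>R u) - ?\<Phi> \<theta>\<^sub>0) / s\<^sup>2) \<longlongrightarrow> (u \<bullet> d\<eta> u) / 2) (at_right 0)" for u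
    using second_difference_expansion[OF U(1,2) \<Phi>_deriv eta_deriv(1), of 0 u] linear_0[OF H_lin]
    by (simp add: theta0(2) inner_commute)
  have H_nonneg: "0 \<le> u \<bullet> d\<eta> u" for u
  proof -
    have "((\<lambda>s::real. \<theta>\<^sub>0 + s *\<^sub>R u) \<longlongrightarrow> \<theta>\<^sub>0 + 0 *\<^sub>R u) (at_right 0)" by (intro tendsto_intros)
    then have "\<forall>\<^sub>F s in at_right 0. \<theta>\<^sub>0 + s *\<^sub>R u \<in> interior \<Theta>"
      using topological_tendstoD[OF _ open_interior] theta0(1) by fastforce
    then have "\<forall>\<^sub>F s in at_right 0. 0 \<le> (?\<Phi> (\<theta>\<^sub>0 + s *\<^sub>R u) - ?\<Phi> \<theta>\<^sub>0) / s\<^sup>2"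
    proof eventually_elim
      case (elim s)
      then show ?case
        using convex_on_gradient_ineq[OF \<Phi>_convex theta0(1) _ \<Phi>_deriv[OF U(2)], of "\<theta>\<^sub>0 + s *\<^sub>R u"]
          subsetD[OF interior_subset elim]
        by (intro divide_nonneg_nonneg) (simp_all add: theta0(2))
    qed
    from tendsto_lowerbound[OF expansion this] show ?thesis by simp
  qed
  obtain c where c: "c > 0" "\<And>x. c * (norm x)\<^sup>2 \<le> x \<bullet> d\<eta> x"
    using positive_definite_of_injective[OF H_lin bij_is_inj[OF eta_deriv(3)] H_sym H_nonneg] by blast
  have Hi: "linear (inv d\<eta>)" "\<And>x. d\<eta> (inv d\<eta> x) = x"
    using linear_inv_of_bij[OF H_lin eta_deriv(3)] eta_deriv(3) by (auto simp: bij_is_surj surj_f_inv_f)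

  interpret C: convex_M_estimation F \<Theta> L \<phi> J \<theta>\<^sub>0 d\<eta> "inv d\<eta>" c
  proof (rule convex_M_estimation.intro)
    show "integrable F (\<lambda>z. L z \<theta>)" if "\<theta> \<in> \<Theta>" for \<theta> by (rule L_integrable[OF that])
    show "convex_on \<Theta> (L z)" if "z \<in> space F" for z using L_convex that spF by simp
    show "L2_fun F (\<lambda>z. \<phi> z \<theta>)" if "\<theta> \<in> interior \<Theta>" for \<theta> using \<phi>_L2 that interior_subset by blast
  qed (fact F_prob theta0(1) L_deriv J_convex E_deriv[OF theta0(1)] expansion H_lin H_sym c Hi)+

  \<comment> \<open>the functional is only specified at laws with a minimizer, so existence is a hypothesis here\<close>
  have minimizer: "is_arg_min f (\<lambda>\<theta>. \<theta> \<in> \<Theta>) (T G)"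
    if "prob_space G" "sets G = sets N" "\<And>\<theta>. \<theta> \<in> \<Theta> \<Longrightarrow> integrable G (\<lambda>z. L z \<theta>)"
      "\<And>\<theta>. \<theta> \<in> \<Theta> \<Longrightarrow> integrable G (\<lambda>z. \<phi> z \<theta>)"
      "\<And>\<theta>. \<theta> \<in> \<Theta> \<Longrightarrow> (\<integral>z. L z \<theta> \<partial>G) + J \<theta> = f \<theta>" "\<exists>\<theta>. is_arg_min f (\<lambda>\<theta>. \<theta> \<in> \<Theta>) \<theta>" for G f
  proof -
    have "G \<in> \<D>" using that by (simp add: D functional_domain_def)
    moreover have "is_arg_min (regularized_risk L J G) (\<lambda>\<theta>. \<theta> \<in> \<Theta>) = is_arg_min f (\<lambda>\<theta>. \<theta> \<in> \<Theta>)"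
      using that(5) by (intro is_arg_min_on_cong) (simp add: regularized_risk_def)
    ultimately show ?thesis using T that(6) unfolding M_functional_def by metis
  qed

  have TF: "T F = \<theta>\<^sub>0"
    by (rule C.population_minimizer(2)[OF minimizer[OF F_prob sF L_integrable \<phi>_int _ C.population_minimizer(1)]])
       (simp_all add: regularized_risk_def)

  have IC_curve: "influence_curve T F C.\<psi>"
    unfolding influence_curve_def TF
  proof (intro ballI tendstoI)
    fix z and e :: real assume z: "z \<in> space F" and e: "e > 0"
    have R: "prob_space (return F z)" "sets (return F z) = sets F" using z by (auto intro: prob_space_return)
    have "\<forall>\<^sub>F t in at_right 0. 0 < t \<and> t < (1::real)"
      using eventually_at_right_real[OF zero_less_one] by (auto elim: eventually_mono)
    with C.contaminated_minimizers[OF z e]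
    show "\<forall>\<^sub>F t in at_right 0. dist ((T (mixture t F (return F z)) - \<theta>\<^sub>0) /\<^sub>R t) (C.\<psi> z) < e"
    proof eventually_elim
      case (elim t)
      then have t: "0 \<le> t" "t \<le> 1" by auto
      have "is_arg_min (\<lambda>\<theta>. (1 - t) * ?E \<theta> + t * L z \<theta> + J \<theta>) (\<lambda>\<theta>. \<theta> \<in> \<Theta>) (T (mixture t F (return F z)))"
      proof (rule minimizer)
        show "prob_space (mixture t F (return F z))" by (rule prob_space_mixture[OF F_prob R t])
        show "sets (mixture t F (return F z)) = sets N" using sets_mixture[OF F_prob R t] sF by simp
        fix \<theta> assume \<theta>: "\<theta> \<in> \<Theta>"
        have Lr: "integrable (return F z) (\<lambda>z. L z \<theta>)"
          by (rule integrable_return_measure[OF z borel_measurable_integrable[OF L_integrable[OF \<theta>]]])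
        show "integrable (mixture t F (return F z)) (\<lambda>z. L z \<theta>)"
          by (rule integrable_mixture[OF F_prob R t L_integrable[OF \<theta>] Lr])
        show "integrable (mixture t F (return F z)) (\<lambda>z. \<phi> z \<theta>)"
          by (intro integrable_mixture[OF F_prob R t] \<phi>_int[OF \<theta>] integrable_return_measure[OF z]
              borel_measurable_integrable)
        show "(\<integral>z. L z \<theta> \<partial>mixture t F (return F z)) + J \<theta> = (1 - t) * ?E \<theta> + t * L z \<theta> + J \<theta>"
          using integral_mixture[OF F_prob R t L_integrable[OF \<theta>] Lr]
            integral_return[OF z borel_measurable_integrable[OF L_integrable[OF \<theta>]]] by simp
      qed (use elim in blast)
      then show ?case using elim by (simp add: dist_norm)
    qed
  qed

  have "small_o_prob M (\<lambda>n. 1 / sqrt (real n)) (\<lambda>n \<omega>. S n \<omega> - (\<theta>\<^sub>0 + (\<Sum>i<n. C.\<psi> (Z i \<omega>)) /\<^sub>R real n))"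
    unfolding small_o_prob_def
  proof (intro allI impI)
    fix e :: real assume e: "e > 0"
    let ?B = "\<lambda>n. {\<omega>\<in>space M. norm (S n \<omega> - (\<theta>\<^sub>0 + (\<Sum>i<n. C.\<psi> (Z i \<omega>)) /\<^sub>R real n)) > e * (1 / sqrt (real n))}"
    show "(\<lambda>n. measure M (?B n)) \<longlonglongrightarrow> 0"
    proof (rule tendstoI)
      fix r :: real assume r: "r > 0"
      show "\<forall>\<^sub>F n in sequentially. dist (measure M (?B n)) 0 < r"
        using C.empirical_minimizers[OF M Z_indep Z_distr e r] eventually_gt_at_top[of 0]
      proof eventually_elim
        case (elim n)
        let ?f = "\<lambda>\<omega> \<theta>. (\<Sum>i<n. L (Z i \<omega>) \<theta>) / real n + J \<theta>"
        have n: "n > 0" using elim by simp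
        obtain A where A: "A \<in> sets M" "measure M A < r"
          and near: "\<forall>\<omega>\<in>space M - A. (\<exists>x. is_arg_min (?f \<omega>) (\<lambda>x. x \<in> \<Theta>) x) \<and>
            (\<forall>x. is_arg_min (?f \<omega>) (\<lambda>x. x \<in> \<Theta>) x \<longrightarrow>
              norm (sqrt n *\<^sub>R (x - \<theta>\<^sub>0) - (\<Sum>i<n. C.\<psi> (Z i \<omega>)) /\<^sub>R sqrt n) < e)"
          using elim(1) by (elim bexE conjE)
        have "?B n \<subseteq> A"
        proof (intro subsetI, rule ccontr)
          fix \<omega> assume \<omega>: "\<omega> \<in> ?B n" "\<omega> \<notin> A"
          have Zsp: "Z i \<omega> \<in> space N" for i
            using Z_indep \<omega>(1) measurable_space[of "Z i" M N \<omega>] by (simp add: M.indep_vars_def2)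
          let ?G = "empirical_measure N (\<lambda>i. Z i \<omega>) n"
          have "is_arg_min (?f \<omega>) (\<lambda>\<theta>. \<theta> \<in> \<Theta>) (T ?G)"
            using near \<omega>
            by (intro minimizer prob_space_empirical sets_empirical integrable_empirical n Zsp L_meas \<phi>_meas)
              (simp_all add: integral_empirical[OF n Zsp L_meas])
          then have "norm (sqrt n *\<^sub>R (S n \<omega> - \<theta>\<^sub>0) - (\<Sum>i<n. C.\<psi> (Z i \<omega>)) /\<^sub>R sqrt n) < e"
            using near \<omega> by (simp add: S)
          moreover have scaled: "sqrt n *\<^sub>R (S n \<omega> - \<theta>\<^sub>0) - (\<Sum>i<n. C.\<psi> (Z i \<omega>)) /\<^sub>R sqrt n
              = sqrt n *\<^sub>R (S n \<omega> - (\<theta>\<^sub>0 + (\<Sum>i<n. C.\<psi> (Z i \<omega>)) /\<^sub>R real n))"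
          proof -
            have "sqrt n * inverse (real n) = inverse (sqrt n)"
              using n by (simp add: field_simps flip: real_sqrt_mult)
            then show ?thesis by (simp add: scaleR_diff_right scaleR_add_right)
          qed
          ultimately have "sqrt n * norm (S n \<omega> - (\<theta>\<^sub>0 + (\<Sum>i<n. C.\<psi> (Z i \<omega>)) /\<^sub>R real n)) < e"
            unfolding scaled norm_scaleR by simp
          moreover have "e * (1 / sqrt n) < norm (S n \<omega> - (\<theta>\<^sub>0 + (\<Sum>i<n. C.\<psi> (Z i \<omega>)) /\<^sub>R real n))"
            using \<omega>(1) by blast
          ultimately show False using n by (simp only: mult_1_right times_divide_eq_right) (simp add: pos_divide_less_eq mult.commute)
        qed
        then have "measure M (?B n) \<le> measure M A" using A(1) by (rule M.finite_measure_mono)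
        then show ?case using A(2) by simp
      qed
    qed
  qed
  moreover have "C.\<psi> \<in> Psi2 F (\<Lambda> \<theta>\<^sub>0)" using IC[OF theta0(1)] IC_curve by (simp add: F)
  ultimately show ?thesis unfolding asymptotically_linear_def using IC_curve by blast
qed

end
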